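(* Let $R$ be a commutative ring with unit, let $\mathcal{A}$ be a set (alphabet), and let $\mu:\mathcal{A}\times\mathcal{A}\to R$ be a mapping. Let $\mathcal{Q}$ be the algebra of phrases in the alphabet $\mathcal{A}$ (empty words allowed), and let $\Delta=\Delta_\mu:\mathcal{Q}\to\mathcal{Q}\otimes\mathcal{Q}$ be the unique algebra homomorphism such that for every word $w$ (including the empty word), $$\Delta(w)=w\otimes 1+\sum_{\alpha}\mu(w,\alpha)\,l_\alpha(w)\otimes r_\alpha(w),$$ where $\alpha$ runs over all inscriptions in $w$ (including the empty inscription). Then the algebra $\mathcal{Q}$ with comultiplication $\Delta$ is a Hopf algebra (i.e., a bialgebra with a counit and an antipode).
   Context: All tensor products are over $R$. Words. A word of length $m\ge 0$ is a finite sequence $w=w(1)\cdots w(m)$ of elements of $\mathcal{A}$; the word of length $0$ is the empty word $\phi$; concatenation is denoted $wx$. For a word $w$ of length $m\ge1$ and $1\le i\le j\le m+1$, $w_{i,j}=w(i)w(i+1)\cdots w(j-1)$ (empty iff $i=j$). Phrases. A phrase of length $k\ge0$ is a finite sequence $(w_1|w_2|\cdots|w_k)$ of $k$ words, some or all of which may be empty; the empty phrase ($k=0$) is denoted $1$ (it is different from the one-word phrase $(\phi)$). $\mathcal{Q}$ is the free $R$-module with basis the set of all phrases, with multiplication given by concatenation of phrases, $(w_1|\cdots|w_k)(x_1|\cdots|x_t)=(w_1|\cdots|w_k|x_1|\cdots|x_t)$; it is an associative algebra with unit $1$. A word $w$ is identified with the one-word phrase $(w)$. Multiplication in $\mathcal{Q}\otimes\mathcal{Q}$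 is $(a\otimes a')(b\otimes b')=ab\otimes a'b'$. Inscriptions. Let $w$ be a word of length $m\ge0$. An inscription in $w$ of length $k\ge0$ is a subset $\alpha\subset\{1,\ldots,m\}$ with $2k$ elements, written in increasing order as $\alpha=(i_1,j_1,\ldots,i_k,j_k)$ with $i_1<j_1<i_2<j_2<\cdots<i_k<j_k$. Set $$l_\alpha(w)=(w_{i_1+1,j_1}|w_{i_2+1,j_2}|\cdots|w_{i_k+1,j_k})\in\mathcal{Q},\qquad \mu(w,\alpha)=\prod_{u=1}^k\mu(w(i_u),w(j_u))\in R,$$ and let $r_\alpha(w)$ be the word $w_{1,i_1}w_{j_1+1,i_2}\cdots w_{j_{k-1}+1,i_k}w_{j_k+1,m+1}$. For $\alpha=\emptyset$: $l_\alpha(w)=1$, $\mu(w,\alpha)=1$, $r_\alpha(w)=w$. *)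

theory Defs
  imports Complex_Main "HOL-Library.Poly_Mapping" "HOL-Library.Product_Plus"
begin

section \<open>Free modules and their tensor products\<close>

text \<open>
  The type \<^typ>\<open>'b \<Rightarrow>\<^sub>0 'r\<close> is the free \<open>'r\<close>-module with basis \<open>'b\<close>; the basis element
  given by \<open>b\<close> is \<open>single b 1\<close>. If \<open>'b\<close> is a monoid (written additively), the library
  multiplication on this type is the bilinear extension of the operation of \<open>'b\<close>, with
  unit \<open>single 0 1\<close>.
\<close>

definition fscale :: "'r::comm_ring_1 \<Rightarrow> ('b \<Rightarrow>\<^sub>0 'r) \<Rightarrow> ('b \<Rightarrow>\<^sub>0 'r)" where
  "fscale c x = Poly_Mapping.map ((*) c) x"

abbreviation basis :: "'b \<Rightarrow> ('b \<Rightarrow>\<^sub>0 'r::comm_ring_1)" where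
  "basis b \<equiv> Poly_Mapping.single b 1"

lemma lookup_fscale [simp]: "Poly_Mapping.lookup (fscale c x) b = c * Poly_Mapping.lookup x b"
  unfolding fscale_def by (transfer, auto simp: when_def)

interpretation free_module: module fscale
  by standard (auto intro!: poly_mapping_eqI simp: lookup_add algebra_simps)

lemma module_times: "module ((*) :: 'r::comm_ring_1 \<Rightarrow> 'r \<Rightarrow> 'r)"
  by standard (auto simp: algebra_simps)

lemma fscale_mult_left: "fscale c x * y = fscale c (x * y)"
  for x y :: "'b::monoid_add \<Rightarrow>\<^sub>0 'r::comm_ring_1"
  by (simp add: fscale_def mult_map_scale_conv_mult mult.assoc)

lemma fscale_mult_right: "x * fscale c y = fscale c (x * y)"
  for x y :: "'b::monoid_add \<Rightarrow>\<^sub>0 'r::comm_ring_1"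
proof -
  have comm: "x * Poly_Mapping.single 0 c = Poly_Mapping.single 0 c * x"
  proof -
    have "Sum_any (\<lambda>q. Poly_Mapping.lookup (Poly_Mapping.single 0 c) q when k = l + q) = (c when k = l)" for k l :: 'b
    proof -
      have "(\<lambda>q. Poly_Mapping.lookup (Poly_Mapping.single 0 c) q when k = l + q) =
            (\<lambda>q. (c when k = l) when q = 0)"
        by (rule ext) (auto simp: when_def lookup_single)
      then show ?thesis by (simp only: Sum_any_when_equal)
    qed
    then have "Poly_Mapping.lookup (x * Poly_Mapping.single 0 c) k = Poly_Mapping.lookup x k * c" for k
      by (simp add: lookup_mult mult_when)
    moreover have "Poly_Mapping.lookup (Poly_Mapping.single 0 c * x) k = c * Poly_Mapping.lookup x k" for k
      by (metis fscale_def lookup_fscale mult_map_scale_conv_mult)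
    ultimately show ?thesis
      by (intro poly_mapping_eqI) (simp add: mult.commute)
  qed
  show ?thesis
    by (simp add: fscale_def mult_map_scale_conv_mult mult.assoc [symmetric] comm)
qed

lemma module_hom_mult_left: "module_hom fscale fscale (\<lambda>x. x * y)"
  for y :: "'b::monoid_add \<Rightarrow>\<^sub>0 'r::comm_ring_1"
  by unfold_locales (simp_all add: distrib_right fscale_mult_left)

lemma module_hom_mult_right: "module_hom fscale fscale (\<lambda>y. x * y)"
  for x :: "'b::monoid_add \<Rightarrow>\<^sub>0 'r::comm_ring_1"
  by unfold_locales (simp_all add: distrib_left fscale_mult_right)

text \<open>
  The tensor product of the free modules on \<open>'b\<close> and \<open>'c\<close> is realised as the free module on
  \<^typ>\<open>'b \<times> 'c\<close>; see \<open>tensor_universal\<close> below for its universal property.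
\<close>

definition tensor :: "('b \<Rightarrow>\<^sub>0 'r::comm_ring_1) \<Rightarrow> ('c \<Rightarrow>\<^sub>0 'r) \<Rightarrow> ('b \<times> 'c \<Rightarrow>\<^sub>0 'r)"
    (infixr \<open>\<otimes>\<close> 75) where
  "x \<otimes> y = (\<Sum>b\<in>Poly_Mapping.keys x. \<Sum>c\<in>Poly_Mapping.keys y. Poly_Mapping.single (b, c) (Poly_Mapping.lookup x b * Poly_Mapping.lookup y c))"

definition linear_ext :: "('r::comm_ring_1 \<Rightarrow> 'm::ab_group_add \<Rightarrow> 'm) \<Rightarrow> ('b \<Rightarrow> 'm) \<Rightarrow> ('b \<Rightarrow>\<^sub>0 'r) \<Rightarrow> 'm" where
  "linear_ext s f x = (\<Sum>b\<in>Poly_Mapping.keys x. s (Poly_Mapping.lookup x b) (f b))"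

text \<open>The linear map out of the tensor product induced by a bilinear map \<open>B\<close>.\<close>

definition tensor_lift ::
    "('r::comm_ring_1 \<Rightarrow> 'm::ab_group_add \<Rightarrow> 'm) \<Rightarrow>
     (('b \<Rightarrow>\<^sub>0 'r) \<Rightarrow> ('c \<Rightarrow>\<^sub>0 'r) \<Rightarrow> 'm) \<Rightarrow> ('b \<times> 'c \<Rightarrow>\<^sub>0 'r) \<Rightarrow> 'm" where
  "tensor_lift s B = linear_ext s (\<lambda>(b, c). B (basis b) (basis c))"

lemma lookup_tensor: "Poly_Mapping.lookup (x \<otimes> y) (b, c) = Poly_Mapping.lookup x b * Poly_Mapping.lookup y c"
proof -
  have "Poly_Mapping.lookup (x \<otimes> y) (b, c) =
      (\<Sum>b'\<in>Poly_Mapping.keys x. \<Sum>c'\<in>Poly_Mapping.keys y. if b' = b then if c' = c then Poly_Mapping.lookup x b * Poly_Mapping.lookup y c else 0 else 0)"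
    unfolding tensor_def lookup_sum
    by (intro sum.cong refl) (auto simp: lookup_single when_def)
  also have "\<dots> = (\<Sum>b'\<in>Poly_Mapping.keys x. if b' = b then (\<Sum>c'\<in>Poly_Mapping.keys y. if c' = c then Poly_Mapping.lookup x b * Poly_Mapping.lookup y c else 0) else 0)"
    by (intro sum.cong refl) auto
  also have "\<dots> = Poly_Mapping.lookup x b * Poly_Mapping.lookup y c"
    by (auto simp: in_keys_iff)
  finally show ?thesis .
qed

lemma tensor_basis [simp]: "basis b \<otimes> basis c = basis (b, c)"
  by (rule poly_mapping_eqI) (auto simp: lookup_tensor lookup_single when_def split: prod.splits if_splits)

lemma module_hom_tensor_right: "module_hom fscale fscale (\<lambda>y. x \<otimes> y)"
  by unfold_locales (auto intro!: poly_mapping_eqI simp: lookup_tensor lookup_add algebra_simps)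

lemma module_hom_tensor_left: "module_hom fscale fscale (\<lambda>x. x \<otimes> y)"
  by unfold_locales (auto intro!: poly_mapping_eqI simp: lookup_tensor lookup_add algebra_simps)

lemma expand_basis: "x = (\<Sum>b\<in>Poly_Mapping.keys x. fscale (Poly_Mapping.lookup x b) (basis b))"
proof (rule poly_mapping_eqI)
  fix k
  have "Poly_Mapping.lookup (\<Sum>b\<in>Poly_Mapping.keys x. fscale (Poly_Mapping.lookup x b) (basis b)) k =
        (\<Sum>b\<in>Poly_Mapping.keys x. if b = k then Poly_Mapping.lookup x k else 0)"
    unfolding lookup_sum by (intro sum.cong refl) (auto simp: lookup_single when_def)
  then show "Poly_Mapping.lookup x k = Poly_Mapping.lookup (\<Sum>b\<in>Poly_Mapping.keys x. fscale (Poly_Mapping.lookup x b) (basis b)) k"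
    by (simp add: in_keys_iff)
qed

lemma module_hom_eq_linear_ext:
  assumes "module_hom fscale s f"
  shows "f = linear_ext s (\<lambda>b. f (basis b))"
proof
  fix x
  interpret module_hom fscale s f by fact
  have "f x = f (\<Sum>b\<in>Poly_Mapping.keys x. fscale (Poly_Mapping.lookup x b) (basis b))"
    using expand_basis [of x] by simp
  also have "\<dots> = linear_ext s (\<lambda>b. f (basis b)) x"
    by (simp add: sum scale linear_ext_def)
  finally show "f x = linear_ext s (\<lambda>b. f (basis b)) x" .
qed

context
  fixes s :: "'r::comm_ring_1 \<Rightarrow> 'm::ab_group_add \<Rightarrow> 'm"
  assumes s: "module s"
begin

interpretation m: module s by (rule s)

lemma linear_ext_superset:
  assumes "finite A" "Poly_Mapping.keys x \<subseteq> A"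
  shows "linear_ext s f x = (\<Sum>b\<in>A. s (Poly_Mapping.lookup x b) (f b))"
  unfolding linear_ext_def using assms
  by (intro sum.mono_neutral_left) (auto simp: in_keys_iff)

lemma linear_ext_basis: "linear_ext s f (basis b) = f b"
  by (simp add: linear_ext_def)

lemma module_hom_linear_ext:
  fixes f :: "'b \<Rightarrow> 'm"
  shows "module_hom fscale s (linear_ext s f)"
proof (intro module_hom.intro module_hom_axioms.intro free_module.module_axioms s)
  fix x y :: "'b \<Rightarrow>\<^sub>0 'r" and r :: 'r
  have "Poly_Mapping.keys (x + y) \<subseteq> Poly_Mapping.keys x \<union> Poly_Mapping.keys y" by (rule Poly_Mapping.keys_add)
  then show "linear_ext s f (x + y) = linear_ext s f x + linear_ext s f y"
    by (simp add: linear_ext_superset [of "Poly_Mapping.keys x \<union> Poly_Mapping.keys y"] lookup_add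
        m.scale_left_distrib sum.distrib)
  have "Poly_Mapping.keys (fscale r x) \<subseteq> Poly_Mapping.keys x" by (auto simp: in_keys_iff)
  then show "linear_ext s f (fscale r x) = s r (linear_ext s f x)"
    by (simp add: linear_ext_superset [of "Poly_Mapping.keys x"] m.scale_sum_right)
qed

lemma module_hom_eqI_basis:
  assumes "module_hom fscale s f" "module_hom fscale s g" "\<And>b. f (basis b) = g (basis b)"
  shows "f = g"
  using module_hom_eq_linear_ext [OF assms(1)] module_hom_eq_linear_ext [OF assms(2)] assms(3)
  by simp

lemma module_hom_tensor_lift: "module_hom fscale s (tensor_lift s B)"
  unfolding tensor_lift_def by (rule module_hom_linear_ext)

lemma tensor_lift_tensor:
  assumes "\<And>x. module_hom fscale s (B x)" "\<And>y. module_hom fscale s (\<lambda>x. B x y)"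
  shows "tensor_lift s B (x \<otimes> y) = B x y"
proof -
  note comp = module_hom_compose [OF _ module_hom_tensor_lift, unfolded o_def]
  have 1: "(\<lambda>y. tensor_lift s B (basis b \<otimes> y)) = B (basis b)" for b
    by (rule module_hom_eqI_basis [OF comp [OF module_hom_tensor_right] assms(1)])
      (simp add: tensor_lift_def linear_ext_basis)
  have "(\<lambda>x. tensor_lift s B (x \<otimes> y)) = (\<lambda>x. B x y)"
    by (rule module_hom_eqI_basis [OF comp [OF module_hom_tensor_left] assms(2)])
      (simp add: 1 [THEN fun_cong])
  then show ?thesis by (rule fun_cong)
qed

lemma tensor_universal:
  assumes "\<And>x. module_hom fscale s (B x)" "\<And>y. module_hom fscale s (\<lambda>x. B x y)"
  shows "\<exists>!f. module_hom fscale s f \<and> (\<forall>x y. f (x \<otimes> y) = B x y)"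
proof (rule ex1I [of _ "tensor_lift s B"])
  show "module_hom fscale s (tensor_lift s B) \<and> (\<forall>x y. tensor_lift s B (x \<otimes> y) = B x y)"
    using module_hom_tensor_lift tensor_lift_tensor [of B, OF assms] by blast
next
  fix f assume f: "module_hom fscale s f \<and> (\<forall>x y. f (x \<otimes> y) = B x y)"
  show "f = tensor_lift s B"
  proof (rule module_hom_eqI_basis)
    show "module_hom fscale s f" using f by blast
    show "f (basis b) = tensor_lift s B (basis b)" for b
      using f by (cases b) (metis tensor_basis tensor_lift_tensor [of B, OF assms])
  qed (rule module_hom_tensor_lift)
qed

end

definition tensor_map ::
    "(('b \<Rightarrow>\<^sub>0 'r::comm_ring_1) \<Rightarrow> ('d \<Rightarrow>\<^sub>0 'r)) \<Rightarrow> (('c \<Rightarrow>\<^sub>0 'r) \<Rightarrow> ('e \<Rightarrow>\<^sub>0 'r)) \<Rightarrow>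
     ('b \<times> 'c \<Rightarrow>\<^sub>0 'r) \<Rightarrow> ('d \<times> 'e \<Rightarrow>\<^sub>0 'r)" where
  "tensor_map f g = tensor_lift fscale (\<lambda>x y. f x \<otimes> g y)"

definition tensor_assoc :: "(('b \<times> 'c) \<times> 'd \<Rightarrow>\<^sub>0 'r::comm_ring_1) \<Rightarrow> ('b \<times> 'c \<times> 'd \<Rightarrow>\<^sub>0 'r)" where
  "tensor_assoc = tensor_lift fscale (\<lambda>u z. tensor_lift fscale (\<lambda>x y. x \<otimes> y \<otimes> z) u)"

lemma tensor_map_tensor:
  assumes "module_hom fscale fscale f" "module_hom fscale fscale g"
  shows "tensor_map f g (x \<otimes> y) = f x \<otimes> g y"
  unfolding tensor_map_def
  by (rule tensor_lift_tensor [OF free_module.module_axioms])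
    (use module_hom_compose [OF assms(2) module_hom_tensor_right]
      module_hom_compose [OF assms(1) module_hom_tensor_left] in \<open>simp_all add: o_def\<close>)

lemma tensor_assoc_tensor: "tensor_assoc ((x \<otimes> y) \<otimes> z) = x \<otimes> (y \<otimes> z)"
proof -
  note fm = free_module.module_axioms
  let ?I = "\<lambda>z. tensor_lift fscale (\<lambda>x y. x \<otimes> y \<otimes> z)"
  have inner: "?I z (x \<otimes> y) = x \<otimes> y \<otimes> z" for x y z
    by (rule tensor_lift_tensor [OF fm])
      (use module_hom_compose [OF module_hom_tensor_left module_hom_tensor_right]
        module_hom_tensor_left in \<open>simp_all add: o_def\<close>)
  have B: "module_hom fscale fscale (\<lambda>z. ?I z u)" for u
  proof (intro module_hom.intro module_hom_axioms.intro fm)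
    interpret I: module_hom fscale fscale "?I z" for z by (rule module_hom_tensor_lift [OF fm])
    interpret T: module_hom fscale fscale "\<lambda>y. x \<otimes> y" for x by (rule module_hom_tensor_right)
    show "?I (z + z') u = ?I z u + ?I z' u" for z z'
      by (simp add: tensor_lift_def linear_ext_def T.add case_prod_unfold
          free_module.scale_right_distrib sum.distrib)
    show "?I (fscale r z) u = fscale r (?I z u)" for r z
      by (simp add: tensor_lift_def linear_ext_def T.scale case_prod_unfold
          free_module.scale_sum_right mult.commute)
  qed
  have "tensor_assoc ((x \<otimes> y) \<otimes> z) = ?I z (x \<otimes> y)"
    unfolding tensor_assoc_def
    by (rule tensor_lift_tensor [OF fm B module_hom_tensor_lift [OF fm]])
  then show ?thesis by (simp add: inner)
qed

text \<open>
  If \<open>'b\<close> and \<open>'c\<close> are monoids, the multiplication of \<^typ>\<open>'b \<times> 'c \<Rightarrow>\<^sub>0 'r\<close> (for the componentwise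
  operation on \<^typ>\<open>'b \<times> 'c\<close>) is the usual one of a tensor product of algebras.
\<close>

lemma tensor_mult: "(x \<otimes> x') * (y \<otimes> y') = (x * y) \<otimes> (x' * y')"
  for x y :: "'b::monoid_add \<Rightarrow>\<^sub>0 'r::comm_ring_1" and x' y' :: "'c::monoid_add \<Rightarrow>\<^sub>0 'r"
proof -
  note fm = free_module.module_axioms
  note mulL = module_hom_mult_left and mulR = module_hom_mult_right
  note cmp = module_hom_compose [unfolded o_def]
  note TR = module_hom_tensor_right and TL = module_hom_tensor_left
  have 0: "(basis b \<otimes> basis b') * (basis c \<otimes> basis c') =
      (basis b * basis c) \<otimes> (basis b' * basis c' :: 'c \<Rightarrow>\<^sub>0 'r)" for b c :: 'b and b' c' :: 'c
    by (simp add: mult_single plus_prod_def)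
  have 1: "(basis b \<otimes> basis b') * (basis c \<otimes> y') =
      (basis b * basis c) \<otimes> (basis b' * y')" for b c :: 'b and b' :: 'c and y' :: "'c \<Rightarrow>\<^sub>0 'r"
    by (rule module_hom_eqI_basis [OF fm cmp [OF TR mulR] cmp [OF mulR TR] 0, THEN fun_cong])
  have 2: "(basis b \<otimes> basis b') * (y \<otimes> y') = (basis b * y) \<otimes> (basis b' * y')"
    for b :: 'b and b' :: 'c and y :: "'b \<Rightarrow>\<^sub>0 'r" and y' :: "'c \<Rightarrow>\<^sub>0 'r"
    by (rule module_hom_eqI_basis [OF fm cmp [OF TL mulR] cmp [OF mulR TL] 1, THEN fun_cong])
  have 3: "(basis b \<otimes> x') * (y \<otimes> y') = (basis b * y) \<otimes> (x' * y')"
    for b :: 'b and x' y' :: "'c \<Rightarrow>\<^sub>0 'r" and y :: "'b \<Rightarrow>\<^sub>0 'r"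
    by (rule module_hom_eqI_basis [OF fm cmp [OF TR mulL] cmp [OF mulL TR] 2, THEN fun_cong])
  show ?thesis
    by (rule module_hom_eqI_basis [OF fm cmp [OF TL mulL] cmp [OF mulL TL] 3, THEN fun_cong])
qed

lemma tensor_one: "(1 :: 'b::monoid_add \<Rightarrow>\<^sub>0 'r::comm_ring_1) \<otimes> (1 :: 'c::monoid_add \<Rightarrow>\<^sub>0 'r) = 1"
  by (metis tensor_basis single_one zero_prod_def)


section \<open>Hopf algebras\<close>

locale algebra_hom = module_hom s1 s2 f
  for s1 :: "'r::comm_ring_1 \<Rightarrow> 'a::ring_1 \<Rightarrow> 'a"
    and s2 :: "'r \<Rightarrow> 'b::ring_1 \<Rightarrow> 'b"
    and f :: "'a \<Rightarrow> 'b" +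
  assumes hom_one: "f 1 = 1"
    and hom_mult: "f (x * y) = f x * f y"

text \<open>
  In the counit axioms \<^term>\<open>tensor_lift fscale (\<lambda>x y. fscale (\<epsilon> x) y)\<close> is \<open>\<epsilon> \<otimes> id\<close> followed by the
  canonical isomorphism of \<open>R \<otimes> A\<close> with \<open>A\<close>, and similarly on the other side.
\<close>

locale coalgebra = comult: module_hom fscale fscale \<Delta> + counit: module_hom fscale "(*)" \<epsilon>
  for \<Delta> :: "('b \<Rightarrow>\<^sub>0 'r::comm_ring_1) \<Rightarrow> ('b \<times> 'b \<Rightarrow>\<^sub>0 'r)" and \<epsilon> :: "('b \<Rightarrow>\<^sub>0 'r) \<Rightarrow> 'r" +
  assumes coassoc: "tensor_assoc (tensor_map \<Delta> id (\<Delta> a)) = tensor_map id \<Delta> (\<Delta> a)"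
    and counit_left: "tensor_lift fscale (\<lambda>x y. fscale (\<epsilon> x) y) (\<Delta> a) = a"
    and counit_right: "tensor_lift fscale (\<lambda>x y. fscale (\<epsilon> y) x) (\<Delta> a) = a"

locale bialgebra = coalgebra \<Delta> \<epsilon> + comult: algebra_hom fscale fscale \<Delta> + counit: algebra_hom fscale "(*)" \<epsilon>
  for \<Delta> :: "('b::monoid_add \<Rightarrow>\<^sub>0 'r::comm_ring_1) \<Rightarrow> ('b \<times> 'b \<Rightarrow>\<^sub>0 'r)" and \<epsilon> :: "('b \<Rightarrow>\<^sub>0 'r) \<Rightarrow> 'r"

locale hopf_algebra = bialgebra \<Delta> \<epsilon> + antipode: module_hom fscale fscale S
  for \<Delta> :: "('b::monoid_add \<Rightarrow>\<^sub>0 'r::comm_ring_1) \<Rightarrow> ('b \<times> 'b \<Rightarrow>\<^sub>0 'r)" and \<epsilon> :: "('b \<Rightarrow>\<^sub>0 'r) \<Rightarrow> 'r"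
    and S :: "('b \<Rightarrow>\<^sub>0 'r) \<Rightarrow> ('b \<Rightarrow>\<^sub>0 'r)" +
  assumes antipode_left: "tensor_lift fscale (\<lambda>x y. S x * y) (\<Delta> a) = fscale (\<epsilon> a) 1"
    and antipode_right: "tensor_lift fscale (\<lambda>x y. x * S y) (\<Delta> a) = fscale (\<epsilon> a) 1"


section \<open>Words, phrases and inscriptions\<close>

text \<open>
  Words over the alphabet \<open>'a\<close> are lists. Phrases are lists of words, wrapped in a type of their
  own so that they carry the monoid structure given by concatenation of phrases.
\<close>

datatype 'a phrase = Phrase (phrase_words: "'a list list")

instantiation phrase :: (type) monoid_add
begin

definition zero_phrase :: "'a phrase" where
  "0 = Phrase []"

definition plus_phrase :: "'a phrase \<Rightarrow> 'a phrase \<Rightarrow> 'a phrase" where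
  "p + q = Phrase (phrase_words p @ phrase_words q)"

instance
  by standard (simp_all add: zero_phrase_def plus_phrase_def)

end

type_synonym ('a, 'r) phrase_algebra = "'a phrase \<Rightarrow>\<^sub>0 'r"

definition word :: "'a list \<Rightarrow> ('a, 'r::comm_ring_1) phrase_algebra" where
  "word w = basis (Phrase [w])"

text \<open>
  Positions in words are counted from 1: \<open>letter w i\<close> is \<open>w(i)\<close>, and \<open>subword w i j\<close> is
  \<open>w(i) w(i+1) \<dots> w(j-1)\<close>.
\<close>

definition letter :: "'a list \<Rightarrow> nat \<Rightarrow> 'a" where
  "letter w i = w ! (i - 1)"

definition subword :: "'a list \<Rightarrow> nat \<Rightarrow> nat \<Rightarrow> 'a list" where
  "subword w i j = map (letter w) [i..<j]"

definition inscriptions :: "'a list \<Rightarrow> nat set set" where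
  "inscriptions w = {\<alpha>. \<alpha> \<subseteq> {1..length w} \<and> even (card \<alpha>)}"

text \<open>For \<open>\<alpha> = (i\<^sub>1, j\<^sub>1, \<dots>, i\<^sub>k, j\<^sub>k)\<close> in increasing order, the lists of the \<open>i\<^sub>u\<close> and of the \<open>j\<^sub>u\<close>.\<close>

definition lefts :: "nat set \<Rightarrow> nat list" where
  "lefts \<alpha> = map (\<lambda>u. sorted_list_of_set \<alpha> ! (2 * u)) [0..<card \<alpha> div 2]"

definition rights :: "nat set \<Rightarrow> nat list" where
  "rights \<alpha> = map (\<lambda>u. sorted_list_of_set \<alpha> ! (2 * u + 1)) [0..<card \<alpha> div 2]"

definition inscription_left :: "'a list \<Rightarrow> nat set \<Rightarrow> ('a, 'r::comm_ring_1) phrase_algebra" where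
  "inscription_left w \<alpha> = basis (Phrase (map2 (\<lambda>i j. subword w (i + 1) j) (lefts \<alpha>) (rights \<alpha>)))"

definition inscription_right :: "'a list \<Rightarrow> nat set \<Rightarrow> 'a list" where
  "inscription_right w \<alpha> =
     concat (map2 (subword w) (1 # map (\<lambda>j. j + 1) (rights \<alpha>)) (lefts \<alpha> @ [length w + 1]))"

definition inscription_weight :: "('a \<times> 'a \<Rightarrow> 'r::comm_ring_1) \<Rightarrow> 'a list \<Rightarrow> nat set \<Rightarrow> 'r" where
  "inscription_weight \<mu> w \<alpha> =
     prod_list (map2 (\<lambda>i j. \<mu> (letter w i, letter w j)) (lefts \<alpha>) (rights \<alpha>))"

lemma inscription_empty [simp]:
  "inscription_left w {} = 1" "inscription_weight \<mu> w {} = 1" "inscription_right w {} = w"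
proof -
  have "map (letter w) [1..<length w + 1] = w"
    by (rule nth_equalityI) (simp_all add: letter_def del: upt_Suc)
  then show "inscription_right w {} = w"
    by (simp add: inscription_right_def lefts_def rights_def subword_def del: upt_Suc)
qed (simp_all add: inscription_left_def inscription_weight_def lefts_def rights_def
    flip: zero_phrase_def)

definition is_comultiplication ::
    "('a \<times> 'a \<Rightarrow> 'r::comm_ring_1) \<Rightarrow>
     (('a, 'r) phrase_algebra \<Rightarrow> ('a phrase \<times> 'a phrase \<Rightarrow>\<^sub>0 'r)) \<Rightarrow> bool" where
  "is_comultiplication \<mu> \<Delta> \<longleftrightarrow>
     algebra_hom fscale fscale \<Delta> \<and>
     (\<forall>w. \<Delta> (word w) = word w \<otimes> 1 +
        (\<Sum>\<alpha>\<in>inscriptions w. fscale (inscription_weight \<mu> w \<alpha>)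
            (inscription_left w \<alpha> \<otimes> word (inscription_right w \<alpha>))))"

definition comultiplication ::
    "('a \<times> 'a \<Rightarrow> 'r::comm_ring_1) \<Rightarrow>
     ('a, 'r) phrase_algebra \<Rightarrow> ('a phrase \<times> 'a phrase \<Rightarrow>\<^sub>0 'r)" where
  "comultiplication \<mu> = (THE \<Delta>. is_comultiplication \<mu> \<Delta>)"

lemma finite_inscriptions [simp]: "finite (inscriptions w)"
  by (rule finite_subset [of _ "Pow {1..length w}"]) (auto simp: inscriptions_def)

lemma basis_phrase: "basis (Phrase ws) = prod_list (map word ws)"
  by (induction ws)
    (simp_all add: word_def mult_single plus_phrase_def flip: zero_phrase_def,
      metis mult_1 mult_single append_Cons append_Nil phrase.sel plus_phrase_def)

text \<open>Algebra homomorphisms from the phrase algebra are freely determined by their values on words.\<close>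

lemma phrase_algebra_free:
  fixes s :: "'r::comm_ring_1 \<Rightarrow> 'm::ring_1 \<Rightarrow> 'm"
  assumes "module s" and sl: "\<And>c x y. s c x * y = s c (x * y)" and sr: "\<And>c x y. x * s c y = s c (x * y)"
  shows "\<exists>!F. algebra_hom fscale s F \<and> (\<forall>w :: 'a list. F (word w) = f w)"
proof (rule ex1I)
  note s = assms(1)
  interpret m: module s by fact
  define F where "F = linear_ext s (\<lambda>p. prod_list (map f (phrase_words p)))"
  interpret F: module_hom fscale s F
    unfolding F_def by (rule module_hom_linear_ext [OF s])
  have Fb: "F (basis p) = prod_list (map f (phrase_words p))" for p
    unfolding F_def by (rule linear_ext_basis [OF s])
  have fm: "module (fscale :: 'r \<Rightarrow> ('a, 'r) phrase_algebra \<Rightarrow> _)" by unfold_locales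
  note cmp = module_hom_compose [unfolded o_def]
  have FL: "module_hom fscale s (\<lambda>x. F (x * y))" "module_hom fscale s (\<lambda>x. F x * F y)"
    "module_hom fscale s (\<lambda>y. F (x * y))" "module_hom fscale s (\<lambda>y. F x * F y)" for x y
    by (intro module_hom.intro module_hom_axioms.intro fm s;
        simp add: distrib_right distrib_left fscale_mult_left fscale_mult_right F.add F.scale sl sr)+
  have 0: "F (basis p * basis q) = F (basis p) * F (basis q)" for p q
    by (simp add: mult_single Fb plus_phrase_def)
  have 1: "F (basis p * y) = F (basis p) * F y" for p y
    by (rule module_hom_eqI_basis [OF s FL(3,4) 0, THEN fun_cong])
  have 2: "F (x * y) = F x * F y" for x y
    by (rule module_hom_eqI_basis [OF s FL(1,2) 1, THEN fun_cong])
  have 3: "F 1 = 1"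
    using Fb [of 0] by (simp add: zero_phrase_def) (metis single_one zero_phrase_def)
  show "algebra_hom fscale s F \<and> (\<forall>w. F (word w) = f w)"
    by (intro conjI allI algebra_hom.intro algebra_hom_axioms.intro F.module_hom_axioms 2 3)
      (simp add: word_def Fb)
  fix G assume G: "algebra_hom fscale s G \<and> (\<forall>w. G (word w) = f w)"
  interpret G: algebra_hom fscale s G using G by blast
  show "G = F"
  proof (rule module_hom_eqI_basis [OF s G.module_hom_axioms F.module_hom_axioms])
    fix p :: "'a phrase"
    obtain ws where p: "p = Phrase ws" by (cases p)
    have "G (prod_list (map word ws)) = prod_list (map f ws)"
      using G by (induction ws) (simp_all add: G.hom_one G.hom_mult)
    then show "G (basis p) = F (basis p)"
      by (simp add: p Fb basis_phrase [symmetric])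
  qed
qed

lemma ex1_comultiplication: "\<exists>!\<Delta>. is_comultiplication \<mu> \<Delta>"
  unfolding is_comultiplication_def
  by (rule phrase_algebra_free) (simp_all add: free_module.module_axioms fscale_mult_left fscale_mult_right)

lemma is_comultiplication_comultiplication: "is_comultiplication \<mu> (comultiplication \<mu>)"
  unfolding comultiplication_def by (rule theI' [OF ex1_comultiplication])

end

theory Submission
  imports Defs
begin

text \<open>
  An inscription in \<open>aw\<close> either avoids the letter \<open>a\<close> or brackets it with a letter \<open>b\<close> of
  \<open>w = vbz\<close> and continues with an inscription in \<open>z\<close>. By induction along this recursion, both sides
  of coassociativity on a word are the same sum over nested systems of brackets; as \<open>\<Delta>\<close> is
  multiplicative, words suffice. The counit kills all nonempty phrases. A left antipode is found by
  recursion on the length of words, because nonempty inscriptions only produce shorter words, and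
  associativity of convolution shows that it is also a right antipode.
\<close>

section \<open>The recursive structure of inscriptions\<close>

text \<open>Inscriptions are sets of positions, while the recursion lives on lists.
  \<open>inscription_sum\<close> bridges this by carrying an arbitrary function \<open>F\<close> of
  the left words and the right word: dropping the first letter only replaces \<open>F l r\<close> by
  \<open>F l (a # r)\<close> or \<open>F (v # l) r\<close>, and the inductions quantify over
  \<open>F\<close>. In coassociativity the hard case is a second inscription that pairs
  \<open>a\<close> with a letter of the right word \<open>a # r\<close>. The letters between the two
  are no subword of \<open>w\<close>, since first-level brackets have been cut out of them;
  \<open>inscription_sum_split_sum\<close> pulls this choice back to \<open>w\<close>. The antipode
  reverses products, so its two identities do not compare algebra homomorphisms and freeness does
  not reduce them to words. One-sided ideals do so instead: \<open>m (S tensor id)\<close> has a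
  right ideal as kernel and \<open>m (id tensor S)\<close> a left ideal, where \<open>m\<close> is
  the multiplication.\<close>

lemma letter_append: "i \<ge> 1 \<Longrightarrow> letter (u @ w) (length u + i) = letter w i"
  by (cases i) (simp_all add: letter_def)

text \<open>Position 0 must be excluded: by truncated subtraction \<open>letter w 0\<close> is the
  first letter of \<open>w\<close>, while position \<open>length u\<close> of \<open>u @ w\<close>
  is the last letter of a nonempty \<open>u\<close>.\<close>

lemma subword_append:
  assumes "i \<ge> 1"
  shows "subword (u @ w) (length u + i) (length u + j) = subword w i j"
proof -
  have "[length u + i..<length u + j] = map ((+) (length u)) [i..<j]"
    by (rule nth_equalityI) simp_all
  then show ?thesis
    using assms by (simp add: subword_def letter_append)
qed

lemma subword_prefix: "subword (u @ w) 1 (length u + 1) = u"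
  by (rule nth_equalityI) (simp_all add: subword_def letter_def nth_append del: upt_Suc)

lemma subword_split: "i \<le> j \<Longrightarrow> j \<le> k \<Longrightarrow> subword w i k = subword w i j @ subword w j k"
  by (metis subword_def le_Suc_ex upt_add_eq_append map_append)

lemma finite_inscription: "\<alpha> \<in> inscriptions w \<Longrightarrow> finite \<alpha>"
  by (auto simp: inscriptions_def intro: finite_subset)

lemma inscription_bounds:
  assumes "\<alpha> \<in> inscriptions w"
  shows "i \<in> set (lefts \<alpha>) \<Longrightarrow> i \<in> {1..length w}" "i \<in> set (rights \<alpha>) \<Longrightarrow> i \<in> {1..length w}"
proof -
  have fin: "finite \<alpha>" and sub: "\<alpha> \<subseteq> {1..length w}"
    using assms finite_inscription by (auto simp: inscriptions_def)
  have *: "sorted_list_of_set \<alpha> ! k \<in> {1..length w}" if "k < card \<alpha>" for k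
    using nth_mem [of k "sorted_list_of_set \<alpha>"] that fin sub by auto
  show "i \<in> set (lefts \<alpha>) \<Longrightarrow> i \<in> {1..length w}" "i \<in> set (rights \<alpha>) \<Longrightarrow> i \<in> {1..length w}"
    unfolding lefts_def rights_def by (auto simp only: set_map set_upt image_iff; intro *; auto)+
qed

lemma sorted_list_of_set_shift:
  "finite \<alpha> \<Longrightarrow> sorted_list_of_set ((+) n ` \<alpha>) = map ((+) n) (sorted_list_of_set \<alpha>)" for n :: nat
  using sorted_list_of_set.idem_if_sorted_distinct [of "map ((+) n) (sorted_list_of_set \<alpha>)"]
  by (simp add: sorted_map distinct_map)

lemma lefts_shift: "finite \<alpha> \<Longrightarrow> lefts ((+) n ` \<alpha>) = map ((+) n) (lefts \<alpha>)"
  and rights_shift: "finite \<alpha> \<Longrightarrow> rights ((+) n ` \<alpha>) = map ((+) n) (rights \<alpha>)"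
  by (auto simp: lefts_def rights_def sorted_list_of_set_shift card_image)

section \<open>Brackets opened at the first letter\<close>

text \<open>In a word \<open>a # v @ b # w\<close> with \<open>n = length v + 2\<close>, this is the
  inscription that opens at \<open>a\<close>, closes at \<open>b\<close> and continues with \<alpha>
  in \<open>w\<close>.\<close>

definition bracket :: "nat \<Rightarrow> nat set \<Rightarrow> nat set" where
  "bracket n \<alpha> = insert 1 (insert n ((+) n ` \<alpha>))"

text \<open>The two new positions precede all shifted ones, so the parity of the old entries in the
  sorted list is preserved: \<open>(1, n)\<close> becomes the first pair and the old pairs are
  inherited.\<close>

lemma bracket_lefts_rights:
  assumes "finite \<alpha>" "\<alpha> \<subseteq> {1..}" "n \<ge> 2"
  shows "card (bracket n \<alpha>) = card \<alpha> + 2"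
    and "lefts (bracket n \<alpha>) = 1 # map ((+) n) (lefts \<alpha>)"
    and "rights (bracket n \<alpha>) = n # map ((+) n) (rights \<alpha>)"
proof -
  have card: "card (bracket n \<alpha>) = card \<alpha> + 2"
    using assms by (subst bracket_def, subst card_insert_disjoint; (subst card_insert_disjoint)?) (auto simp: card_image)
  have sorted: "sorted_list_of_set (bracket n \<alpha>) = 1 # n # map ((+) n) (sorted_list_of_set \<alpha>)" (is "_ = ?xs")
  proof -
    have "set ?xs = bracket n \<alpha>" using assms by (simp add: bracket_def)
    moreover have "sorted ?xs" "distinct ?xs"
      using assms by (auto simp: sorted_map distinct_map)
    ultimately show ?thesis
      using sorted_list_of_set.idem_if_sorted_distinct by metis
  qed
  show "card (bracket n \<alpha>) = card \<alpha> + 2" by (fact card)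
  have upt: "map f [0..<card (bracket n \<alpha>) div 2] = f 0 # map (\<lambda>u. f (Suc u)) [0..<card \<alpha> div 2]" for f :: "nat \<Rightarrow> nat"
    by (simp add: card map_upt_Suc del: upt_Suc)
  show "lefts (bracket n \<alpha>) = 1 # map ((+) n) (lefts \<alpha>)"
    "rights (bracket n \<alpha>) = n # map ((+) n) (rights \<alpha>)"
    using assms(1) unfolding lefts_def rights_def upt sorted by auto
qed

definition left_words :: "'a list \<Rightarrow> nat set \<Rightarrow> 'a list list" where
  "left_words w \<alpha> = map2 (\<lambda>i j. subword w (i + 1) j) (lefts \<alpha>) (rights \<alpha>)"

text \<open>The content of a bracket ends before its closing position, which is at most
  \<open>length w\<close>. The strict decrease makes \<open>antipode_word\<close> terminate.\<close>

lemma length_left_words: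
  assumes "\<alpha> \<in> inscriptions w" "v \<in> set (left_words w \<alpha>)"
  shows "length v < length w"
proof -
  obtain i j where v: "v = subword w (i + 1) j" and "(i, j) \<in> set (zip (lefts \<alpha>) (rights \<alpha>))"
    using assms(2) by (auto simp: left_words_def)
  then have "j \<in> set (rights \<alpha>)" by (blast dest: set_zip_rightD)
  then show ?thesis
    using inscription_bounds(2) [OF assms(1), of j] by (auto simp: v subword_def)
qed

lemma map2_shift:
  fixes n :: nat
  assumes "\<And>i j. i \<in> set xs \<Longrightarrow> j \<in> set ys \<Longrightarrow> f (n + i) (n + j) = g i j"
  shows "map2 f (map ((+) n) xs) (map ((+) n) ys) = map2 g xs ys"
  using assms
  by (auto simp: map_zip_map map_zip_map2 zip_map_map dest: set_zip_leftD set_zip_rightD)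

lemma subwords_shift:
  "map2 (\<lambda>i j. subword (u @ w) (i + 1) j) (map ((+) (length u)) xs) (map ((+) (length u)) ys) =
   map2 (\<lambda>i j. subword w (i + 1) j) xs ys"
  by (rule map2_shift) (metis add.assoc le_add2 subword_append)

lemma weights_shift:
  assumes "\<alpha> \<in> inscriptions w"
  shows "map2 (\<lambda>i j. \<mu> (letter (u @ w) i, letter (u @ w) j))
     (map ((+) (length u)) (lefts \<alpha>)) (map ((+) (length u)) (rights \<alpha>)) =
   map2 (\<lambda>i j. \<mu> (letter w i, letter w j)) (lefts \<alpha>) (rights \<alpha>)"
  using inscription_bounds [OF assms] by (intro map2_shift) (auto simp: letter_append)

lemma gaps_shift:
  "map2 (subword (u @ w)) (map (\<lambda>j. j + 1) (map ((+) (length u)) xs)) (map ((+) (length u)) ys) =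
   map2 (subword w) (map (\<lambda>j. j + 1) xs) ys"
proof -
  have "map2 (subword (u @ w)) (map ((+) (length u)) (map (\<lambda>j. j + 1) xs)) (map ((+) (length u)) ys) =
   map2 (subword w) (map (\<lambda>j. j + 1) xs) ys"
    by (rule map2_shift) (auto simp: subword_append simp del: add_Suc_right)
  then show ?thesis by (simp add: o_def)
qed

text \<open>The initial gap is split off because it starts at the fixed position 1, whereas all
  other gaps simply move when a prefix is put before \<open>w\<close>.\<close>

lemma inscription_right_shape:
  assumes "\<alpha> \<in> inscriptions w"
  obtains x xs where "lefts \<alpha> @ [length w + 1] = x # xs" "x \<ge> 1"
    "inscription_right w \<alpha> = subword w 1 x @ concat (map2 (subword w) (map (\<lambda>j. j + 1) (rights \<alpha>)) xs)"
proof -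
  obtain x xs where x: "lefts \<alpha> @ [length w + 1] = x # xs"
    by (metis append_is_Nil_conv list.exhaust not_Cons_self2)
  then have "x \<in> set (lefts \<alpha> @ [length w + 1])" by simp
  then have "x \<ge> 1" using inscription_bounds(1) [OF assms, of x] by auto
  then show ?thesis
    by (rule that [OF x]) (simp only: inscription_right_def x list.map zip_Cons_Cons split_conv concat.simps)
qed

lemma shift_inscription:
  assumes "\<alpha> \<in> inscriptions w"
  shows "left_words (u @ w) ((+) (length u) ` \<alpha>) = left_words w \<alpha>"
    and "inscription_weight \<mu> (u @ w) ((+) (length u) ` \<alpha>) = inscription_weight \<mu> w \<alpha>"
    and "inscription_right (u @ w) ((+) (length u) ` \<alpha>) = u @ inscription_right w \<alpha>"
proof -
  note fin = finite_inscription [OF assms]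
  show "left_words (u @ w) ((+) (length u) ` \<alpha>) = left_words w \<alpha>"
    by (simp only: left_words_def lefts_shift rights_shift fin subwords_shift)
  show "inscription_weight \<mu> (u @ w) ((+) (length u) ` \<alpha>) = inscription_weight \<mu> w \<alpha>"
    by (simp only: inscription_weight_def lefts_shift rights_shift fin weights_shift [OF assms])
  obtain x xs where x: "lefts \<alpha> @ [length w + 1] = x # xs" "x \<ge> 1"
    "inscription_right w \<alpha> = subword w 1 x @ concat (map2 (subword w) (map (\<lambda>j. j + 1) (rights \<alpha>)) xs)"
    using inscription_right_shape [OF assms] .
  have ends: "map ((+) (length u)) (lefts \<alpha>) @ [length (u @ w) + 1] = (length u + x) # map ((+) (length u)) xs"
    using arg_cong [OF x(1), of "map ((+) (length u))"] by simp
  have "subword (u @ w) 1 (length u + x) = u @ subword w 1 x"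
    using x(2) subword_split [of 1 "length u + 1" "length u + x" "u @ w"]
    by (simp only: subword_prefix subword_append le_refl)
  then show "inscription_right (u @ w) ((+) (length u) ` \<alpha>) = u @ inscription_right w \<alpha>"
    unfolding inscription_right_def [of "u @ w"] lefts_shift [OF fin] rights_shift [OF fin] ends x(3)
    by (simp only: list.map zip_Cons_Cons split_conv concat.simps gaps_shift append_assoc)
qed

text \<open>The gap before position 1 is empty, and the gap after the closing position
  \<open>n\<close> is the shifted initial gap of \<alpha>; so the prefix up to \<open>b\<close>
  leaves no trace in the right word.\<close>

lemma bracket_inscription:
  assumes \<alpha>: "\<alpha> \<in> inscriptions w"
  shows "left_words (a # v @ b # w) (bracket (length v + 2) \<alpha>) = v # left_words w \<alpha>"
    and "inscription_weight \<mu> (a # v @ b # w) (bracket (length v + 2) \<alpha>) = \<mu> (a, b) * inscription_weight \<mu> w \<alpha>"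
    and "inscription_right (a # v @ b # w) (bracket (length v + 2) \<alpha>) = inscription_right w \<alpha>"
proof -
  define u where "u = a # v @ [b]"
  have u: "a # v @ b # w = u @ w" "length v + 2 = length u" by (simp_all add: u_def)
  have "finite \<alpha>" "\<alpha> \<subseteq> {1..}" "length u \<ge> 2"
    using \<alpha> finite_inscription by (auto simp: inscriptions_def u_def)
  note br = bracket_lefts_rights [OF this]
  have "subword (u @ w) (1 + 1) (length u) = v"
  proof -
    have "subword ([a] @ (v @ (b # w))) (length [a] + 1) (length [a] + (length v + 1)) = v"
      by (simp only: subword_append le_refl subword_prefix)
    then show ?thesis by (simp add: u_def)
  qed
  then show "left_words (a # v @ b # w) (bracket (length v + 2) \<alpha>) = v # left_words w \<alpha>"
    unfolding u left_words_def br
    by (simp only: list.map zip_Cons_Cons split_conv subwords_shift)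
  have "letter (u @ w) 1 = a" "letter (u @ w) (length u) = b"
    by (simp_all add: letter_def u_def nth_append)
  then show "inscription_weight \<mu> (a # v @ b # w) (bracket (length v + 2) \<alpha>) = \<mu> (a, b) * inscription_weight \<mu> w \<alpha>"
    unfolding u inscription_weight_def br
    by (simp only: list.map zip_Cons_Cons split_conv weights_shift [OF \<alpha>] prod_list.Cons)
  obtain x xs where x: "lefts \<alpha> @ [length w + 1] = x # xs" "x \<ge> 1"
    "inscription_right w \<alpha> = subword w 1 x @ concat (map2 (subword w) (map (\<lambda>j. j + 1) (rights \<alpha>)) xs)"
    using inscription_right_shape [OF \<alpha>] .
  have ends: "map ((+) (length u)) (lefts \<alpha>) @ [length (u @ w) + 1] = (length u + x) # map ((+) (length u)) xs"
    using arg_cong [OF x(1), of "map ((+) (length u))"] by simp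
  have "subword (u @ w) 1 1 = []" by (simp add: subword_def)
  then show "inscription_right (a # v @ b # w) (bracket (length v + 2) \<alpha>) = inscription_right w \<alpha>"
    unfolding u inscription_right_def [of "u @ w"] br append_Cons ends x(3)
    by (simp only: list.map zip_Cons_Cons split_conv concat.simps gaps_shift append_assoc append_Nil
        subword_append le_refl)
qed

section \<open>Sums over factorizations of a word and over its inscriptions\<close>

definition split_sum :: "('a list \<Rightarrow> 'a \<Rightarrow> 'a list \<Rightarrow> 'm::comm_monoid_add) \<Rightarrow> 'a list \<Rightarrow> 'm" where
  "split_sum F w = (\<Sum>i<length w. F (take i w) (w ! i) (drop (Suc i) w))"

lemma split_sum_Nil [simp]: "split_sum F [] = 0"
  and split_sum_Cons [simp]: "split_sum F (b # w) = F [] b w + split_sum (\<lambda>v c z. F (b # v) c z) w"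
  by (simp_all add: split_sum_def sum.lessThan_Suc_shift del: sum.lessThan_Suc)

lemma split_sum_cong:
  assumes "\<And>v b z. w = v @ b # z \<Longrightarrow> F v b z = G v b z"
  shows "split_sum F w = split_sum G w"
  unfolding split_sum_def by (intro sum.cong refl assms) (auto simp: id_take_nth_drop)

lemma split_sum_add: "split_sum (\<lambda>v b z. F v b z + G v b z) w = split_sum F w + split_sum G w"
  by (simp add: split_sum_def sum.distrib)

text \<open>Both sides run over the factorizations of \<open>w\<close> as
  \<open>t @ c # s @ b # z\<close>; they differ in which marked letter is chosen first.\<close>

lemma split_sum_split_sum:
  "split_sum (\<lambda>v b z. split_sum (\<lambda>t c s. H t c s b z) v) w =
   split_sum (\<lambda>t c z'. split_sum (\<lambda>s b z. H t c s b z) z') w"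
  by (induction w arbitrary: H) (simp_all add: split_sum_add)

text \<open>\<open>F\<close> acts as a continuation: with basis tensors it gives the
  comultiplication, with products the convolutions, and inductions may prepend to either
  argument.\<close>

definition inscription_sum ::
    "('a \<times> 'a \<Rightarrow> 'r::comm_ring_1) \<Rightarrow> ('a list list \<Rightarrow> 'a list \<Rightarrow> ('x \<Rightarrow>\<^sub>0 'r)) \<Rightarrow> 'a list \<Rightarrow> ('x \<Rightarrow>\<^sub>0 'r)" where
  "inscription_sum \<mu> F w = (\<Sum>\<alpha>\<in>inscriptions w.
     fscale (inscription_weight \<mu> w \<alpha>) (F (left_words w \<alpha>) (inscription_right w \<alpha>)))"

lemma inscriptions_Cons_without_1:
  "{\<alpha> \<in> inscriptions (a # w). 1 \<notin> \<alpha>} = (\<lambda>\<alpha>. (+) 1 ` \<alpha>) ` inscriptions w"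
proof (intro set_eqI iffI)
  fix \<alpha> assume \<alpha>: "\<alpha> \<in> {\<alpha> \<in> inscriptions (a # w). 1 \<notin> \<alpha>}"
  have pos: "x \<in> {2..length w + 1}" if "x \<in> \<alpha>" for x
  proof -
    have "x \<in> {1..length w + 1}" "x \<noteq> 1" using \<alpha> that by (auto simp: inscriptions_def)
    then show ?thesis by simp
  qed
  define \<beta> where "\<beta> = (\<lambda>x. x - 1) ` \<alpha>"
  have "(\<lambda>x. 1 + (x - 1)) ` \<alpha> = (\<lambda>x. x) ` \<alpha>"
    by (intro image_cong refl) (auto dest!: pos)
  then have eq: "\<alpha> = (+) 1 ` \<beta>" by (simp add: \<beta>_def image_image)
  have "card \<alpha> = card \<beta>" unfolding eq by (rule card_image) simp
  then have "even (card \<beta>)"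
    using \<alpha> by (simp add: inscriptions_def)
  moreover have "\<beta> \<subseteq> {1..length w}"
    unfolding \<beta>_def by (auto dest!: pos)
  ultimately show "\<alpha> \<in> (\<lambda>\<alpha>. (+) 1 ` \<alpha>) ` inscriptions w"
    using eq by (auto simp: inscriptions_def)
qed (auto simp: inscriptions_def card_image)

lemma bij_betw_bracket:
  "bij_betw (\<lambda>(i, \<alpha>). bracket (i + 2) \<alpha>)
     (SIGMA i:{..<length w}. inscriptions (drop (Suc i) w)) {\<alpha> \<in> inscriptions (a # w). 1 \<in> \<alpha>}"
proof (rule bij_betw_imageI)
  have mem: "x \<in> bracket (i + 2) \<alpha> \<longleftrightarrow> x = 1 \<or> x = i + 2 \<or> x \<ge> i + 2 \<and> x - (i + 2) \<in> \<alpha>" for x i \<alpha>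
    by (auto simp: bracket_def image_iff intro!: bexI [of _ "x - (i + 2)"])
  show "inj_on (\<lambda>(i, \<alpha>). bracket (i + 2) \<alpha>) (SIGMA i:{..<length w}. inscriptions (drop (Suc i) w))"
  proof (rule inj_onI, clarsimp)
    fix i j \<alpha> \<beta>
    assume ab: "\<alpha> \<in> inscriptions (drop (Suc i) w)" "\<beta> \<in> inscriptions (drop (Suc j) w)"
      and eq: "bracket (Suc (Suc i)) \<alpha> = bracket (Suc (Suc j)) \<beta>"
    \<comment> \<open>Position \<open>i + 2\<close> lies in the bracket set whether or not 0 is in
      \<alpha>, so only positive positions can be recovered from it.\<close>
    then have 0: "0 \<notin> \<alpha>" "0 \<notin> \<beta>" by (auto simp: inscriptions_def)
    have eq': "x = 1 \<or> x = i + 2 \<or> x \<ge> i + 2 \<and> x - (i + 2) \<in> \<alpha> \<longleftrightarrow>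
        x = 1 \<or> x = j + 2 \<or> x \<ge> j + 2 \<and> x - (j + 2) \<in> \<beta>" for x
    proof -
      have "bracket (i + 2) \<alpha> = bracket (j + 2) \<beta>" using eq by simp
      then show ?thesis unfolding mem [symmetric] by simp
    qed
    \<comment> \<open>\<open>i + 2\<close> is the least element of its bracket set other than 1, and
      likewise \<open>j + 2\<close>.\<close>
    have ij: "i = j"
      using eq' [of "i + 2"] eq' [of "j + 2"] by auto
    have "x \<in> \<alpha> \<longleftrightarrow> x \<in> \<beta>" for x
      using eq' [of "i + 2 + x"] 0 ij by (cases x) auto
    then show "i = j \<and> \<alpha> = \<beta>" using ij by blast
  qed
  show "(\<lambda>(i, \<alpha>). bracket (i + 2) \<alpha>) ` (SIGMA i:{..<length w}. inscriptions (drop (Suc i) w)) =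
    {\<alpha> \<in> inscriptions (a # w). 1 \<in> \<alpha>}"
  proof (intro set_eqI iffI)
    fix \<beta> assume "\<beta> \<in> (\<lambda>(i, \<alpha>). bracket (i + 2) \<alpha>) ` (SIGMA i:{..<length w}. inscriptions (drop (Suc i) w))"
    then obtain i \<alpha> where i: "i < length w" and \<alpha>: "\<alpha> \<in> inscriptions (drop (Suc i) w)"
      and \<beta>: "\<beta> = bracket (i + 2) \<alpha>" by auto
    have sub: "\<alpha> \<subseteq> {1..length w - Suc i}" "even (card \<alpha>)" using \<alpha> by (auto simp: inscriptions_def)
    then have "card \<beta> = card \<alpha> + 2"
      unfolding \<beta> by (intro bracket_lefts_rights(1) finite_inscription [OF \<alpha>]) auto
    moreover have "i + 2 + x \<in> {1..length w + 1}" if "x \<in> \<alpha>" for x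
    proof -
      have "x \<in> {1..length w - Suc i}" using sub that by blast
      then show ?thesis using i by auto
    qed
    then have "\<beta> \<subseteq> {1..length w + 1}" using i by (auto simp: \<beta> bracket_def)
    moreover have "1 \<in> \<beta>" by (simp add: \<beta> bracket_def)
    ultimately show "\<beta> \<in> {\<alpha> \<in> inscriptions (a # w). 1 \<in> \<alpha>}"
      using sub by (simp add: inscriptions_def)
  next
    fix \<beta> assume "\<beta> \<in> {\<alpha> \<in> inscriptions (a # w). 1 \<in> \<alpha>}"
    then have \<beta>: "\<beta> \<subseteq> {1..length w + 1}" "even (card \<beta>)" "1 \<in> \<beta>"
      by (auto simp: inscriptions_def)
    then have fin: "finite \<beta>" by (auto intro: finite_subset)
    \<comment> \<open>Even cardinality forces an element besides 1; the least such element is the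
      partner of position 1.\<close>
    have ne: "\<beta> - {1} \<noteq> {}" using \<beta>(2,3) by (metis card_1_singleton_iff insert_Diff odd_one One_nat_def)
    define n where "n = Min (\<beta> - {1})"
    have n: "n \<in> \<beta>" "n \<noteq> 1" and least: "\<And>x. x \<in> \<beta> \<Longrightarrow> x \<noteq> 1 \<Longrightarrow> n \<le> x"
      using Min_in [of "\<beta> - {1}"] Min_le [of "\<beta> - {1}"] ne fin by (auto simp: n_def)
    have bounds: "2 \<le> n" "n \<le> length w + 1" using n \<beta>(1) by fastforce+
    define i where "i = n - 2"
    have i: "n = i + 2" "i < length w" using bounds by (auto simp: i_def)
    \<comment> \<open>The position \<open>n + 0\<close> belongs to \<beta> as the closing letter,
      hence the exclusion of 0.\<close>
    define \<alpha> where "\<alpha> = {x. x \<noteq> 0 \<and> n + x \<in> \<beta>}"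
    have sub: "\<alpha> \<subseteq> {1..length w - Suc i}" using \<beta>(1) i by (fastforce simp: \<alpha>_def)
    then have fin': "finite \<alpha>" by (rule finite_subset) simp
    have eq: "\<beta> = bracket n \<alpha>"
    proof (rule set_eqI)
      fix x show "x \<in> \<beta> \<longleftrightarrow> x \<in> bracket n \<alpha>"
      proof -
        have "x \<in> bracket n \<alpha> \<longleftrightarrow> x = 1 \<or> x = n \<or> x \<ge> n \<and> x - n \<in> \<alpha>"
          by (simp only: i(1) mem)
        then show ?thesis
          using least [of x] n(1) \<beta>(3) by (cases "n \<le> x") (auto simp: \<alpha>_def)
      qed
    qed
    have "card \<beta> = card \<alpha> + 2"
      unfolding eq using fin' sub bounds by (intro bracket_lefts_rights(1)) auto
    then have "\<alpha> \<in> inscriptions (drop (Suc i) w)" using sub \<beta>(2) by (simp add: inscriptions_def)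
    then show "\<beta> \<in> (\<lambda>(i, \<alpha>). bracket (i + 2) \<alpha>) ` (SIGMA i:{..<length w}. inscriptions (drop (Suc i) w))"
      using i eq by force
  qed
qed

lemma inscription_sum_Nil [simp]: "inscription_sum \<mu> F ([] :: 'a list) = F [] []"
proof -
  have "inscriptions ([] :: 'a list) = {{}}" by (auto simp: inscriptions_def)
  then show ?thesis by (simp add: inscription_sum_def left_words_def lefts_def)
qed

lemma inscription_sum_Cons:
  "inscription_sum \<mu> F (a # w) = inscription_sum \<mu> (\<lambda>l r. F l (a # r)) w +
     split_sum (\<lambda>v b z. fscale (\<mu> (a, b)) (inscription_sum \<mu> (\<lambda>l r. F (v # l) r) z)) w"
proof -
  define G where "G \<alpha> = fscale (inscription_weight \<mu> (a # w) \<alpha>)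
    (F (left_words (a # w) \<alpha>) (inscription_right (a # w) \<alpha>))" for \<alpha>
  have "inscription_sum \<mu> F (a # w) =
      sum G {\<alpha> \<in> inscriptions (a # w). 1 \<notin> \<alpha>} + sum G {\<alpha> \<in> inscriptions (a # w). 1 \<in> \<alpha>}"
    unfolding inscription_sum_def G_def [symmetric]
    by (subst sum.union_disjoint [symmetric]) (auto intro!: sum.cong)
  also have "sum G {\<alpha> \<in> inscriptions (a # w). 1 \<notin> \<alpha>} = inscription_sum \<mu> (\<lambda>l r. F l (a # r)) w"
  proof -
    have "inj_on (\<lambda>\<alpha>. (+) 1 ` \<alpha>) (inscriptions w)" by (auto intro!: inj_onI simp: inj_image_eq_iff)
    moreover have "G ((+) 1 ` \<alpha>) = fscale (inscription_weight \<mu> w \<alpha>)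
        (F (left_words w \<alpha>) (a # inscription_right w \<alpha>))" if "\<alpha> \<in> inscriptions w" for \<alpha>
      using shift_inscription(1,3) [OF that, of "[a]"] shift_inscription(2) [OF that, of \<mu> "[a]"]
      by (simp add: G_def)
    ultimately show ?thesis
      unfolding inscriptions_Cons_without_1 inscription_sum_def
      by (simp add: sum.reindex del: One_nat_def plus_1_eq_Suc)
  qed
  also have "sum G {\<alpha> \<in> inscriptions (a # w). 1 \<in> \<alpha>} =
      (\<Sum>(i, \<alpha>)\<in>(SIGMA i:{..<length w}. inscriptions (drop (Suc i) w)). G (bracket (i + 2) \<alpha>))"
    by (subst sum.reindex_bij_betw [OF bij_betw_bracket, symmetric]) (simp add: case_prod_unfold)
  also have "\<dots> = (\<Sum>i<length w. \<Sum>\<alpha>\<in>inscriptions (drop (Suc i) w). G (bracket (i + 2) \<alpha>))"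
    by (rule sum.Sigma [symmetric]) auto
  also have "\<dots> = split_sum (\<lambda>v b z. fscale (\<mu> (a, b)) (inscription_sum \<mu> (\<lambda>l r. F (v # l) r) z)) w"
    unfolding split_sum_def inscription_sum_def free_module.scale_sum_right
  proof (intro sum.cong refl)
    fix i \<alpha> assume i: "i \<in> {..<length w}" and \<alpha>: "\<alpha> \<in> inscriptions (drop (Suc i) w)"
    have w: "take i w @ w ! i # drop (Suc i) w = w" "length (take i w) = i"
      using i by (simp_all add: id_take_nth_drop [symmetric])
    show "G (bracket (i + 2) \<alpha>) = fscale (\<mu> (a, w ! i))
        (fscale (inscription_weight \<mu> (drop (Suc i) w) \<alpha>)
           (F (take i w # left_words (drop (Suc i) w) \<alpha>) (inscription_right (drop (Suc i) w) \<alpha>)))"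
      unfolding G_def free_module.scale_scale
      using bracket_inscription(1,3) [OF \<alpha>, where a = a and b = "w ! i" and v = "take i w", unfolded w]
        bracket_inscription(2) [OF \<alpha>, where \<mu> = \<mu> and a = a and b = "w ! i" and v = "take i w", unfolded w]
      by simp
  qed
  finally show ?thesis .
qed

text \<open>Every nonempty inscription removes letters from the right word, so only the empty one
  survives. The right antipode identity uses this.\<close>

lemma inscription_sum_zero_except:
  assumes "\<And>l r. length r < length w \<Longrightarrow> F l r = 0"
  shows "inscription_sum \<mu> F w = F [] w"
  using assms
proof (induction w arbitrary: F rule: length_induct)
  case (1 w)
  show ?case
  proof (cases w)
    case (Cons a w')
    have "inscription_sum \<mu> (\<lambda>l r. F l (a # r)) w' = F [] (a # w')"
      using 1 Cons by simp
    \<comment> \<open>The induction hypothesis leaves only \<open>F [v] z\<close>, and this vanishes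
      too because \<open>z\<close> is shorter than \<open>w\<close>.\<close>
    moreover have "inscription_sum \<mu> (\<lambda>l r. F (v # l) r) z = 0" if "w' = v @ b # z" for v b z
    proof -
      have "inscription_sum \<mu> (\<lambda>l r. F (v # l) r) z = F [v] z"
        using 1 Cons that by simp
      then show ?thesis using 1 Cons that by simp
    qed
    then have "split_sum (\<lambda>v b z. fscale (\<mu> (a, b)) (inscription_sum \<mu> (\<lambda>l r. F (v # l) r) z)) w' =
      split_sum (\<lambda>v b z. 0) w'" by (intro split_sum_cong) simp
    ultimately show ?thesis by (simp add: Cons inscription_sum_Cons) (simp add: split_sum_def)
  qed simp
qed

lemma inscription_sum_zero_Cons:
  assumes "\<And>v l r. F (v # l) r = 0"
  shows "inscription_sum \<mu> F w = F [] w"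
  using assms
proof (induction w arbitrary: F)
  case (Cons a w)
  have "inscription_sum \<mu> (\<lambda>l r. F (v # l) r) z = 0" for v z
    by (simp add: Cons.prems inscription_sum_def)
  then show ?case
    using Cons by (simp add: inscription_sum_Cons) (simp add: split_sum_def)
qed simp

section \<open>Coassociativity\<close>

lemma inscription_sum_add:
  "inscription_sum \<mu> (\<lambda>l r. F l r + G l r) w = inscription_sum \<mu> F w + inscription_sum \<mu> G w"
  by (simp add: inscription_sum_def free_module.scale_right_distrib sum.distrib)

lemma inscription_sum_hom:
  assumes "module_hom fscale fscale h"
  shows "h (inscription_sum \<mu> F w) = inscription_sum \<mu> (\<lambda>l r. h (F l r)) w"
proof -
  interpret module_hom fscale fscale h by fact
  show ?thesis by (simp add: inscription_sum_def sum scale)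
qed

lemma fscale_inscription_sum:
  "fscale c (inscription_sum \<mu> F w) = inscription_sum \<mu> (\<lambda>l r. fscale c (F l r)) w"
  by (simp add: inscription_sum_def free_module.scale_sum_right mult.commute)

lemma fscale_split_sum: "fscale c (split_sum F w) = split_sum (\<lambda>v b z. fscale c (F v b z)) w"
  by (simp add: split_sum_def free_module.scale_sum_right)

lemma inscription_sum_swap:
  "inscription_sum \<mu> (\<lambda>l r. inscription_sum \<mu> (\<lambda>l' r'. F l r l' r') v) w =
   inscription_sum \<mu> (\<lambda>l' r'. inscription_sum \<mu> (\<lambda>l r. F l r l' r') w) v"
  unfolding inscription_sum_def free_module.scale_sum_right free_module.scale_scale
  by (subst sum.swap) (simp add: mult.commute)

text \<open>A letter \<open>b\<close> marked in the right word \<open>r\<close> lies outside all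
  brackets, and no bracket passes over it. So it cuts \<open>w\<close> into \<open>v @ b # z\<close>
  and the inscription into one in \<open>v\<close> and one in \<open>z\<close>.\<close>

lemma inscription_sum_split_sum:
  fixes K :: "'a list list \<Rightarrow> 'a list \<Rightarrow> 'a \<Rightarrow> 'a list \<Rightarrow> ('x \<Rightarrow>\<^sub>0 'r::comm_ring_1)"
  shows "inscription_sum \<mu> (\<lambda>l r. split_sum (K l) r) w =
   split_sum (\<lambda>v b z. inscription_sum \<mu> (\<lambda>l x. inscription_sum \<mu> (\<lambda>l' y. K (l @ l') x b y) z) v) w"
proof (induction w arbitrary: K rule: length_induct)
  case (1 w)
  show ?case
  proof (cases w)
    case (Cons a w')
    define \<Phi> where "\<Phi> K = (\<lambda>v b z.
      inscription_sum \<mu> (\<lambda>l x. inscription_sum \<mu> (\<lambda>l' y. K (l @ l') x b y) z) v)"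
      for K :: "'a list list \<Rightarrow> 'a list \<Rightarrow> 'a \<Rightarrow> 'a list \<Rightarrow> ('x \<Rightarrow>\<^sub>0 'r)"
    have IH: "inscription_sum \<mu> (\<lambda>l r. split_sum (K l) r) z = split_sum (\<Phi> K) z" if "length z < length w" for K z
      using 1 that by (simp add: \<Phi>_def)
    have \<Phi>_Cons: "\<Phi> K (a # v) b z = \<Phi> (\<lambda>l x. K l (a # x)) v b z +
      split_sum (\<lambda>t c s. fscale (\<mu> (a, c)) (\<Phi> (\<lambda>l. K (t # l)) s b z)) v" for v b z
      by (simp add: \<Phi>_def inscription_sum_Cons)
    \<comment> \<open>Three cases: the marked letter is \<open>a\<close> itself, or \<open>a\<close>
      is kept and a later letter is marked, or \<open>a\<close> is bracketed with \<open>c\<close>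
      and the mark lies behind \<open>c\<close>.\<close>
    have "inscription_sum \<mu> (\<lambda>l r. split_sum (K l) r) w =
        inscription_sum \<mu> (\<lambda>l r. K l [] a r) w' + inscription_sum \<mu> (\<lambda>l r. split_sum (\<lambda>x. K l (a # x)) r) w' +
        split_sum (\<lambda>t c z. fscale (\<mu> (a, c)) (inscription_sum \<mu> (\<lambda>l r. split_sum (K (t # l)) r) z)) w'"
      by (simp add: Cons inscription_sum_Cons inscription_sum_add)
    also have "inscription_sum \<mu> (\<lambda>l r. split_sum (\<lambda>x. K l (a # x)) r) w' = split_sum (\<Phi> (\<lambda>l x. K l (a # x))) w'"
      by (rule IH) (simp add: Cons)
    also have "split_sum (\<lambda>t c z. fscale (\<mu> (a, c)) (inscription_sum \<mu> (\<lambda>l r. split_sum (K (t # l)) r) z)) w' =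
       split_sum (\<lambda>t c z'. split_sum (\<lambda>s b z. fscale (\<mu> (a, c)) (\<Phi> (\<lambda>l. K (t # l)) s b z)) z') w'"
      by (intro split_sum_cong, subst IH) (simp_all add: Cons fscale_split_sum)
    also have "inscription_sum \<mu> (\<lambda>l r. K l [] a r) w' = \<Phi> K [] a w'"
      by (simp add: \<Phi>_def)
    finally have "inscription_sum \<mu> (\<lambda>l r. split_sum (K l) r) w = split_sum (\<Phi> K) w"
      by (simp add: Cons \<Phi>_Cons split_sum_add split_sum_split_sum)
    then show ?thesis by (simp only: \<Phi>_def)
  qed simp
qed

text \<open>This is the comultiplication of the phrase \<open>ws\<close> with \<open>H p q\<close>
  in place of the basis tensors (\<open>comultiplication_phrase\<close>); the first summand of the
  second equation comes from \<open>w\<close> tensor 1.\<close>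

primrec phrase_sum ::
    "('a \<times> 'a \<Rightarrow> 'r::comm_ring_1) \<Rightarrow> 'a list list \<Rightarrow>
     ('a list list \<Rightarrow> 'a list list \<Rightarrow> ('x \<Rightarrow>\<^sub>0 'r)) \<Rightarrow> ('x \<Rightarrow>\<^sub>0 'r)" where
  "phrase_sum \<mu> [] H = H [] []"
| "phrase_sum \<mu> (w # ws) H = phrase_sum \<mu> ws (\<lambda>p q. H (w # p) q) +
     inscription_sum \<mu> (\<lambda>l r. phrase_sum \<mu> ws (\<lambda>p q. H (l @ p) (r # q))) w"

lemma phrase_sum_hom:
  assumes "module_hom fscale fscale h"
  shows "h (phrase_sum \<mu> ws H) = phrase_sum \<mu> ws (\<lambda>p q. h (H p q))"
proof -
  interpret module_hom fscale fscale h by fact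
  show ?thesis
    by (induction ws arbitrary: H) (simp_all add: add inscription_sum_hom [OF assms])
qed

text \<open>
  Both sides run over the nested pairs of inscriptions in \<open>w\<close>: on the left the outermost
  brackets are chosen first, on the right those whose content goes to the first tensor factor.
\<close>

lemma nested_inscriptions:
  fixes F :: "'a list list \<Rightarrow> 'a list list \<Rightarrow> 'a list \<Rightarrow> ('x \<Rightarrow>\<^sub>0 'r::comm_ring_1)"
  shows "inscription_sum \<mu> (\<lambda>l r. phrase_sum \<mu> l (\<lambda>p q. F p q r)) w =
   inscription_sum \<mu> (\<lambda>l r. inscription_sum \<mu> (\<lambda>l' r'. F l l' r') r) w"
proof (induction w arbitrary: F rule: length_induct)
  case (1 w)
  show ?case
  proof (cases w)
    case (Cons a w')
    define \<Psi> where "\<Psi> F w = inscription_sum \<mu> (\<lambda>l r. inscription_sum \<mu> (\<lambda>l' r'. F l l' r') r) w"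
      for F :: "'a list list \<Rightarrow> 'a list list \<Rightarrow> 'a list \<Rightarrow> ('x \<Rightarrow>\<^sub>0 'r)" and w
    have IH: "inscription_sum \<mu> (\<lambda>l r. phrase_sum \<mu> l (\<lambda>p q. F p q r)) z = \<Psi> F z" if "length z < length w" for F z
      using 1 that by (simp add: \<Psi>_def)
    \<comment> \<open>In \<open>A\<close> the letter \<open>a\<close> stays in the last factor. In
      \<open>B\<close> and \<open>C\<close> it is bracketed with \<open>b\<close>: in
      \<open>B\<close> the whole content \<open>v\<close> goes to the first factor, in
      \<open>C\<close> an inscription in \<open>v\<close> sends its right word to the middle factor.
      On the other side \<open>C\<close> arises when the second inscription pairs \<open>a\<close>
      with a letter of \<open>r\<close>.\<close>
    define A B C where "A = \<Psi> (\<lambda>p q r. F p q (a # r)) w'"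
      and "B = split_sum (\<lambda>v b z. fscale (\<mu> (a, b)) (\<Psi> (\<lambda>p. F (v # p)) z)) w'"
      and "C = split_sum (\<lambda>v b z. fscale (\<mu> (a, b))
        (inscription_sum \<mu> (\<lambda>l' r'. \<Psi> (\<lambda>p q. F (l' @ p) (r' # q)) z) v)) w'"
    have "inscription_sum \<mu> (\<lambda>l r. phrase_sum \<mu> (v # l) (\<lambda>p q. F p q r)) z =
        \<Psi> (\<lambda>p. F (v # p)) z + inscription_sum \<mu> (\<lambda>l' r'. \<Psi> (\<lambda>p q. F (l' @ p) (r' # q)) z) v"
      if "length z < length w" for v z
    proof -
      have "inscription_sum \<mu> (\<lambda>l r. phrase_sum \<mu> (v # l) (\<lambda>p q. F p q r)) z =
        inscription_sum \<mu> (\<lambda>l r. phrase_sum \<mu> l (\<lambda>p q. F (v # p) q r)) z +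
        inscription_sum \<mu> (\<lambda>l' r'. inscription_sum \<mu> (\<lambda>l r. phrase_sum \<mu> l (\<lambda>p q. F (l' @ p) (r' # q) r)) z) v"
        by (simp add: inscription_sum_add) (rule inscription_sum_swap)
      then show ?thesis by (simp only: IH [OF that])
    qed
    then have "split_sum (\<lambda>v b z. fscale (\<mu> (a, b))
        (inscription_sum \<mu> (\<lambda>l r. phrase_sum \<mu> (v # l) (\<lambda>p q. F p q r)) z)) w' =
      split_sum (\<lambda>v b z. fscale (\<mu> (a, b)) (\<Psi> (\<lambda>p. F (v # p)) z +
        inscription_sum \<mu> (\<lambda>l' r'. \<Psi> (\<lambda>p q. F (l' @ p) (r' # q)) z) v)) w'"
      by (intro split_sum_cong) (simp add: Cons)
    then have left: "inscription_sum \<mu> (\<lambda>l r. phrase_sum \<mu> l (\<lambda>p q. F p q r)) w = A + (B + C)"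
      using IH [of w' "\<lambda>p q r. F p q (a # r)"]
      by (simp add: Cons A_def B_def C_def inscription_sum_Cons split_sum_add free_module.scale_right_distrib
          del: phrase_sum.simps)
    have "inscription_sum \<mu> (\<lambda>l r. split_sum (\<lambda>x b y.
        fscale (\<mu> (a, b)) (inscription_sum \<mu> (\<lambda>l' r'. F l (x # l') r') y)) r) w' = C"
      unfolding inscription_sum_split_sum C_def \<Psi>_def by (simp add: fscale_inscription_sum)
    then have "\<Psi> F w = A + C + B"
      by (simp add: Cons \<Psi>_def A_def B_def inscription_sum_Cons inscription_sum_add)
    then show ?thesis using left by (simp add: \<Psi>_def)
  qed simp
qed

section \<open>Linear and algebra homomorphisms on basis elements\<close>

lemma basis_mult: "basis b * basis c = basis (b + c)"
  by (simp add: mult_single)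

lemma basis_empty_phrase: "basis (Phrase []) = 1"
  by (simp flip: zero_phrase_def)

lemma tensor_lift_basis: "tensor_lift fscale B (basis (b, c)) = B (basis b) (basis c)"
  by (simp add: tensor_lift_def linear_ext_basis [OF free_module.module_axioms])

lemmas module_hom_tensor_lift' = module_hom_tensor_lift [OF free_module.module_axioms]

lemmas free_module_hom_eqI = module_hom_eqI_basis [OF free_module.module_axioms, THEN fun_cong]

lemma tensor_map_basis: "tensor_map f g (basis (b, c)) = f (basis b) \<otimes> g (basis c)"
  by (simp add: tensor_map_def tensor_lift_basis)

lemma tensor_assoc_basis: "tensor_assoc (basis ((b, c), d)) = basis (b, c, d)"
  using tensor_assoc_tensor [of "basis b" "basis c" "basis d"] by simp

lemma module_hom_tensor_map: "module_hom fscale fscale (tensor_map f g)"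
  unfolding tensor_map_def by (rule module_hom_tensor_lift')

lemma module_hom_tensor_assoc: "module_hom fscale fscale tensor_assoc"
  unfolding tensor_assoc_def by (rule module_hom_tensor_lift')

lemma algebra_hom_basisI:
  fixes f :: "('b::monoid_add \<Rightarrow>\<^sub>0 'r::comm_ring_1) \<Rightarrow> ('c::monoid_add \<Rightarrow>\<^sub>0 'r)"
  assumes f: "module_hom fscale fscale f" and one: "f (basis 0) = basis 0"
    and mult: "\<And>b c. f (basis (b + c)) = f (basis b) * f (basis c)"
  shows "algebra_hom fscale fscale f"
proof (intro algebra_hom.intro algebra_hom_axioms.intro f)
  show "f 1 = 1" using one by simp
  note cmp = module_hom_compose [unfolded o_def]
  have 1: "f (basis b * y) = f (basis b) * f y" for b y
    by (rule free_module_hom_eqI [OF cmp [OF module_hom_mult_right f] cmp [OF f module_hom_mult_right]])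
      (simp add: basis_mult mult)
  show "f (x * y) = f x * f y" for x y
    by (rule free_module_hom_eqI [OF cmp [OF module_hom_mult_left f] cmp [OF f module_hom_mult_left] 1])
qed

lemma algebra_hom_compose:
  assumes "algebra_hom s1 s2 f" "algebra_hom s2 s3 g"
  shows "algebra_hom s1 s3 (\<lambda>x. g (f x))"
  using assms module_hom_compose [of s1 s2 f s3 g]
  by (simp add: algebra_hom_def algebra_hom_axioms_def o_def)

lemma algebra_hom_tensor_map:
  fixes f :: "('b::monoid_add \<Rightarrow>\<^sub>0 'r::comm_ring_1) \<Rightarrow> ('d::monoid_add \<Rightarrow>\<^sub>0 'r)"
    and g :: "('c::monoid_add \<Rightarrow>\<^sub>0 'r) \<Rightarrow> ('e::monoid_add \<Rightarrow>\<^sub>0 'r)"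
  assumes "algebra_hom fscale fscale f" "algebra_hom fscale fscale g"
  shows "algebra_hom fscale fscale (tensor_map f g)"
proof -
  interpret f: algebra_hom fscale fscale f by fact
  interpret g: algebra_hom fscale fscale g by fact
  show ?thesis
  proof (rule algebra_hom_basisI [OF module_hom_tensor_map])
    have "tensor_map f g (basis (0, 0)) = 1"
      by (simp add: tensor_map_basis f.hom_one g.hom_one tensor_one)
    then show "tensor_map f g (basis 0) = basis 0" by (simp flip: zero_prod_def)
    show "tensor_map f g (basis (b + c)) = tensor_map f g (basis b) * tensor_map f g (basis c)" for b c
      by (cases b; cases c)
        (simp only: plus_prod_def fst_conv snd_conv tensor_map_basis tensor_mult
          basis_mult [symmetric] f.hom_mult g.hom_mult)
  qed
qed

lemma algebra_hom_tensor_assoc: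
  "algebra_hom fscale fscale
     (tensor_assoc :: (('b::monoid_add \<times> 'c::monoid_add) \<times> 'd::monoid_add \<Rightarrow>\<^sub>0 'r::comm_ring_1) \<Rightarrow> _)"
  by (rule algebra_hom_basisI [OF module_hom_tensor_assoc])
    (auto simp: tensor_assoc_basis zero_prod_def plus_prod_def basis_mult)

lemma algebra_hom_id: "algebra_hom fscale fscale (id :: ('b::monoid_add \<Rightarrow>\<^sub>0 'r::comm_ring_1) \<Rightarrow> _)"
  by (rule algebra_hom_basisI) (simp_all add: basis_mult free_module.module_hom_id)

text \<open>This is the uniqueness half of freeness; it reduces coassociativity and the counit laws
  to words.\<close>

lemma phrase_algebra_hom_eqI:
  fixes F G :: "('a, 'r::comm_ring_1) phrase_algebra \<Rightarrow> ('b::monoid_add \<Rightarrow>\<^sub>0 'r)"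
  assumes "algebra_hom fscale fscale F" "algebra_hom fscale fscale G" "\<And>w. F (word w) = G (word w)"
  shows "F x = G x"
proof -
  have "\<exists>!F. algebra_hom fscale fscale F \<and> (\<forall>w :: 'a list. F (word w) = G (word w))"
    by (rule phrase_algebra_free) (simp_all add: free_module.module_axioms fscale_mult_left fscale_mult_right)
  then show ?thesis using assms by metis
qed

section \<open>The comultiplication on words and phrases\<close>

lemma algebra_hom_comultiplication: "algebra_hom fscale fscale (comultiplication \<mu>)"
  using is_comultiplication_comultiplication [of \<mu>] by (simp add: is_comultiplication_def)

lemma comultiplication_word:
  fixes \<mu> :: "'a \<times> 'a \<Rightarrow> 'r::comm_ring_1"
  shows "comultiplication \<mu> (word w) =
     basis (Phrase [w], 0) + inscription_sum \<mu> (\<lambda>l r. basis (Phrase l, Phrase [r])) w"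
proof -
  have "word w \<otimes> 1 = (basis (Phrase [w], 0) :: 'a phrase \<times> 'a phrase \<Rightarrow>\<^sub>0 'r)"
    unfolding word_def single_one [symmetric] tensor_basis ..
  moreover have "inscription_left w \<alpha> \<otimes> word (inscription_right w \<alpha>) =
      (basis (Phrase (left_words w \<alpha>), Phrase [inscription_right w \<alpha>]) :: 'a phrase \<times> 'a phrase \<Rightarrow>\<^sub>0 'r)" for \<alpha>
    by (simp add: inscription_left_def word_def left_words_def)
  ultimately show ?thesis
    using is_comultiplication_comultiplication [of \<mu>]
    by (simp add: is_comultiplication_def inscription_sum_def)
qed

lemma comultiplication_phrase:
  fixes \<mu> :: "'a \<times> 'a \<Rightarrow> 'r::comm_ring_1"
  shows "comultiplication \<mu> (basis (Phrase ws)) = phrase_sum \<mu> ws (\<lambda>p q. basis (Phrase p, Phrase q))"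
proof (induction ws)
  case Nil
  show ?case
    using algebra_hom.hom_one [OF algebra_hom_comultiplication [of \<mu>]]
    by (simp flip: zero_phrase_def zero_prod_def)
next
  case (Cons w ws)
  have "basis (Phrase (w # ws)) = (word w * basis (Phrase ws) :: ('a, 'r) phrase_algebra)"
    by (simp add: word_def basis_mult plus_phrase_def)
  then have "comultiplication \<mu> (basis (Phrase (w # ws))) =
      comultiplication \<mu> (word w) * comultiplication \<mu> (basis (Phrase ws))"
    by (simp add: algebra_hom.hom_mult [OF algebra_hom_comultiplication])
  also have "\<dots> = basis (Phrase [w], 0) * phrase_sum \<mu> ws (\<lambda>p q. basis (Phrase p, Phrase q)) +
      inscription_sum \<mu> (\<lambda>l r. basis (Phrase l, Phrase [r]) * phrase_sum \<mu> ws (\<lambda>p q. basis (Phrase p, Phrase q))) w"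
    by (simp only: Cons.IH comultiplication_word distrib_right inscription_sum_hom [OF module_hom_mult_left])
  finally show ?case
    by (simp add: phrase_sum_hom [OF module_hom_mult_right] basis_mult plus_prod_def plus_phrase_def zero_phrase_def)
qed

lemma comultiplication_coassoc:
  "tensor_assoc (tensor_map (comultiplication \<mu>) id (comultiplication \<mu> a)) =
   tensor_map id (comultiplication \<mu>) (comultiplication \<mu> a)"
proof (rule phrase_algebra_hom_eqI)
  note hom = algebra_hom_comultiplication [of \<mu>]
  show "algebra_hom fscale fscale (\<lambda>a. tensor_assoc (tensor_map (comultiplication \<mu>) id (comultiplication \<mu> a)))"
    by (rule algebra_hom_compose [OF algebra_hom_compose [OF hom
        algebra_hom_tensor_map [OF hom algebra_hom_id]] algebra_hom_tensor_assoc])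
  show "algebra_hom fscale fscale (\<lambda>a. tensor_map id (comultiplication \<mu>) (comultiplication \<mu> a))"
    by (rule algebra_hom_compose [OF hom algebra_hom_tensor_map [OF algebra_hom_id hom]])
  fix w
  note cmp = module_hom_compose [unfolded o_def]
  note L = cmp [OF module_hom_tensor_map module_hom_tensor_assoc]
  interpret L: module_hom fscale fscale "\<lambda>x. tensor_assoc (tensor_map (comultiplication \<mu>) id x)" by (rule L)
  interpret R: module_hom fscale fscale "tensor_map id (comultiplication \<mu>)" by (rule module_hom_tensor_map)
  interpret T: module_hom fscale fscale "\<lambda>x. basis p \<otimes> x" for p by (rule module_hom_tensor_right)
  have Lb: "tensor_assoc (tensor_map (comultiplication \<mu>) id (basis (Phrase p, q))) =
      phrase_sum \<mu> p (\<lambda>p p'. basis (Phrase p, Phrase p', q))" for p q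
    by (simp add: tensor_map_basis comultiplication_phrase tensor_assoc_basis
        phrase_sum_hom [OF cmp [OF module_hom_tensor_left module_hom_tensor_assoc]])
  have L0: "tensor_assoc (tensor_map (comultiplication \<mu>) id (basis (Phrase [w], 0))) =
      basis (Phrase [w], 0, 0) + inscription_sum \<mu> (\<lambda>l r. basis (Phrase l, Phrase [r], 0)) w"
    by (simp add: Lb zero_phrase_def)
  have R0: "tensor_map id (comultiplication \<mu>) (basis (p, 0)) = basis (p, 0, 0)" for p
    using algebra_hom.hom_one [OF hom] by (simp add: tensor_map_basis flip: zero_prod_def) (simp flip: single_one)
  have Rb: "tensor_map id (comultiplication \<mu>) (basis (p, Phrase [r])) = basis (p, Phrase [r], 0) +
      inscription_sum \<mu> (\<lambda>l r. basis (p, Phrase l, Phrase [r])) r" for p r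
    by (simp add: tensor_map_basis comultiplication_word T.add inscription_sum_hom [OF module_hom_tensor_right]
        flip: word_def)
  \<comment> \<open>The terms ending in 1 already agree on both sides; only the nested sum needs
    \<open>nested_inscriptions\<close>.\<close>
  have "tensor_assoc (tensor_map (comultiplication \<mu>) id (comultiplication \<mu> (word w))) =
      basis (Phrase [w], 0, 0) + inscription_sum \<mu> (\<lambda>l r. basis (Phrase l, Phrase [r], 0)) w +
      inscription_sum \<mu> (\<lambda>l r. phrase_sum \<mu> l (\<lambda>p q. basis (Phrase p, Phrase q, Phrase [r]))) w"
    by (simp only: comultiplication_word L.add inscription_sum_hom [OF L] L0) (simp only: Lb)
  also have "\<dots> = basis (Phrase [w], 0, 0) + inscription_sum \<mu> (\<lambda>l r. basis (Phrase l, Phrase [r], 0) +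
      inscription_sum \<mu> (\<lambda>l' r'. basis (Phrase l, Phrase l', Phrase [r'])) r) w"
    by (simp only: nested_inscriptions inscription_sum_add add.assoc)
  also have "\<dots> = tensor_map id (comultiplication \<mu>) (comultiplication \<mu> (word w))"
    by (simp only: comultiplication_word R.add inscription_sum_hom [OF module_hom_tensor_map] R0 Rb)
  finally show "tensor_assoc (tensor_map (comultiplication \<mu>) id (comultiplication \<mu> (word w))) =
   tensor_map id (comultiplication \<mu>) (comultiplication \<mu> (word w))" .
qed

section \<open>Counit and antipode\<close>

text \<open>Freeness allows the value 0 on every word, including the empty word, which as a one-word
  phrase is a generator different from 1.\<close>

lemma phrase_algebra_counit:
  obtains \<epsilon> :: "('a, 'r::comm_ring_1) phrase_algebra \<Rightarrow> 'r"
  where "algebra_hom fscale (*) \<epsilon>" "\<And>w ws. \<epsilon> (basis (Phrase (w # ws))) = 0"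
proof -
  have "\<exists>!\<epsilon> :: ('a, 'r) phrase_algebra \<Rightarrow> 'r. algebra_hom fscale (*) \<epsilon> \<and> (\<forall>w :: 'a list. \<epsilon> (word w) = 0)"
    by (rule phrase_algebra_free) (simp_all add: module_times)
  then obtain \<epsilon> :: "('a, 'r) phrase_algebra \<Rightarrow> 'r"
    where \<epsilon>: "algebra_hom fscale (*) \<epsilon>" "\<And>w. \<epsilon> (word w) = 0" by blast
  have "\<epsilon> (basis (Phrase (w # ws))) = 0" for w ws
    by (simp add: basis_phrase algebra_hom.hom_mult [OF \<epsilon>(1)] \<epsilon>(2))
  then show ?thesis using that \<epsilon>(1) by blast
qed

definition convolution ::
    "(('b \<Rightarrow>\<^sub>0 'r::comm_ring_1) \<Rightarrow> ('b \<times> 'b \<Rightarrow>\<^sub>0 'r)) \<Rightarrow>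
     (('b \<Rightarrow>\<^sub>0 'r) \<Rightarrow> ('b::monoid_add \<Rightarrow>\<^sub>0 'r)) \<Rightarrow> (('b \<Rightarrow>\<^sub>0 'r) \<Rightarrow> ('b \<Rightarrow>\<^sub>0 'r)) \<Rightarrow>
     ('b \<Rightarrow>\<^sub>0 'r) \<Rightarrow> ('b \<Rightarrow>\<^sub>0 'r)" where
  "convolution \<Delta> f g a = tensor_lift fscale (\<lambda>x y. f x * g y) (\<Delta> a)"

text \<open>\<open>tensor_lift\<close> evaluates \<open>f\<close>, \<open>g\<close>,
  \<open>h\<close> on basis elements only. So one linear map \<open>M\<close> on the triple tensor
  product, given by the threefold product on basis triples, turns the two sides into its values on
  the two sides of coassociativity.\<close>

lemma convolution_assoc:
  assumes \<Delta>: "module_hom fscale fscale \<Delta>"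
    and coassoc: "tensor_assoc (tensor_map \<Delta> id (\<Delta> a)) = tensor_map id \<Delta> (\<Delta> a)"
  shows "convolution \<Delta> (convolution \<Delta> f g) h a = convolution \<Delta> f (convolution \<Delta> g h) a"
proof -
  define M where "M = linear_ext fscale (\<lambda>(b, c, d). f (basis b) * (g (basis c) * h (basis d)))"
  have M: "module_hom fscale fscale M"
    unfolding M_def by (rule module_hom_linear_ext [OF free_module.module_axioms])
  have Mb: "M (basis (b, c, d)) = f (basis b) * (g (basis c) * h (basis d))" for b c d
    by (simp add: M_def linear_ext_basis [OF free_module.module_axioms])
  note cmp = module_hom_compose [unfolded o_def]
  note tl = module_hom_tensor_lift' and tr = module_hom_tensor_right and ta = module_hom_tensor_assoc
    and tm = module_hom_tensor_map
  have R0: "f (basis b) * tensor_lift fscale (\<lambda>x y. g x * h y) u = M (basis b \<otimes> u)" for b u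
    by (rule free_module_hom_eqI [OF cmp [OF tl module_hom_mult_right] cmp [OF tr M]])
      (auto simp: tensor_lift_basis Mb)
  have R: "tensor_lift fscale (\<lambda>x y. f x * convolution \<Delta> g h y) u = M (tensor_map id \<Delta> u)" for u
    by (rule free_module_hom_eqI [OF tl cmp [OF tm M]])
      (auto simp: tensor_lift_basis tensor_map_basis convolution_def R0)
  have L0: "tensor_lift fscale (\<lambda>x y. f x * g y) u * h (basis d) = M (tensor_assoc (u \<otimes> basis d))" for d u
    by (rule free_module_hom_eqI [OF cmp [OF tl module_hom_mult_left] cmp [OF cmp [OF module_hom_tensor_left ta] M]])
      (auto simp: tensor_lift_basis tensor_assoc_basis Mb mult.assoc)
  have L: "tensor_lift fscale (\<lambda>x y. convolution \<Delta> f g x * h y) u = M (tensor_assoc (tensor_map \<Delta> id u))" for u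
    by (rule free_module_hom_eqI [OF tl cmp [OF cmp [OF tm ta] M]])
      (auto simp: tensor_lift_basis tensor_map_basis convolution_def L0)
  show ?thesis
    using L [of "\<Delta> a"] R [of "\<Delta> a"]
    by (simp only: convolution_def [of \<Delta> "convolution \<Delta> f g" h a] convolution_def [of \<Delta> f "convolution \<Delta> g h" a] coassoc)
qed

text \<open>
  The left antipode identity on a word \<open>w\<close>, solved for the term \<open>S(w) \<otimes> 1\<close>. The words of
  \<open>l\<^sub>\<alpha>(w)\<close> are shorter than \<open>w\<close>, so this is a recursion for an anti-multiplicative \<open>S\<close>.
\<close>

function antipode_word :: "('a \<times> 'a \<Rightarrow> 'r::comm_ring_1) \<Rightarrow> 'a list \<Rightarrow> ('a, 'r) phrase_algebra" where
  "antipode_word \<mu> w = - (\<Sum>\<alpha>\<in>inscriptions w. fscale (inscription_weight \<mu> w \<alpha>)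
     (prod_list (rev (map (antipode_word \<mu>) (left_words w \<alpha>))) * word (inscription_right w \<alpha>)))"
  by pat_completeness auto
termination
  by (relation "measure (\<lambda>(\<mu>, w). length w)") (auto simp: length_left_words)

declare antipode_word.simps [simp del]

definition antipode :: "('a \<times> 'a \<Rightarrow> 'r::comm_ring_1) \<Rightarrow> ('a, 'r) phrase_algebra \<Rightarrow> ('a, 'r) phrase_algebra" where
  "antipode \<mu> = linear_ext fscale (\<lambda>p. prod_list (rev (map (antipode_word \<mu>) (phrase_words p))))"

lemma module_hom_antipode: "module_hom fscale fscale (antipode \<mu>)"
  unfolding antipode_def by (rule module_hom_linear_ext [OF free_module.module_axioms])

lemma antipode_basis:
  "antipode \<mu> (basis p) = prod_list (rev (map (antipode_word \<mu>) (phrase_words p)))"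
  by (simp add: antipode_def linear_ext_basis [OF free_module.module_axioms])

lemma antipode_add: "antipode \<mu> (basis (p + q)) = antipode \<mu> (basis q) * antipode \<mu> (basis p)"
  by (simp add: antipode_basis plus_phrase_def)

lemma antipode_one: "antipode \<mu> 1 = 1"
  using antipode_basis [of \<mu> "Phrase []"] by (simp add: basis_empty_phrase)

lemma antipode_word_eq:
  "antipode \<mu> (word w) = - inscription_sum \<mu> (\<lambda>l r. antipode \<mu> (basis (Phrase l)) * word r) w"
  unfolding word_def [of w]
  by (simp add: antipode_basis inscription_sum_def) (rule antipode_word.simps)

lemma convolution_comultiplication_word:
  "convolution (comultiplication \<mu>) f g (word w) =
     f (word w) * g 1 + inscription_sum \<mu> (\<lambda>l r. f (basis (Phrase l)) * g (word r)) w"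
proof -
  note hom = module_hom_tensor_lift'
  have "convolution (comultiplication \<mu>) f g (word w) =
      tensor_lift fscale (\<lambda>x y. f x * g y) (basis (Phrase [w], 0)) +
      tensor_lift fscale (\<lambda>x y. f x * g y) (inscription_sum \<mu> (\<lambda>l r. basis (Phrase l, Phrase [r])) w)"
    unfolding convolution_def comultiplication_word by (rule module_hom.add [OF hom])
  then show ?thesis
    by (simp add: inscription_sum_hom [OF hom] tensor_lift_basis word_def)
qed

lemma convolution_one:
  "convolution (comultiplication \<mu>) f g 1 = f 1 * g 1"
proof -
  have "comultiplication \<mu> 1 = basis (0, 0)"
    using algebra_hom.hom_one [OF algebra_hom_comultiplication [of \<mu>]] by (simp flip: zero_prod_def)
  then show ?thesis by (simp add: convolution_def tensor_lift_basis)
qed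

lemma comultiplication_Cons:
  "comultiplication \<mu> (basis (Phrase (w # ws))) = comultiplication \<mu> (word w) * comultiplication \<mu> (basis (Phrase ws))"
  by (simp add: basis_phrase algebra_hom.hom_mult [OF algebra_hom_comultiplication])

lemma module_hom_zero: "module_hom fscale fscale (\<lambda>_. 0)"
  by unfold_locales simp_all

text \<open>Anti-multiplicativity gives \<open>?T (X * (c tensor d)) = S c * ?T X * d\<close>, so
  the kernel is a right ideal. Hence the left identity on a phrase follows from its first
  word.\<close>

lemma antipode_left_mult:
  assumes "tensor_lift fscale (\<lambda>x y. antipode \<mu> x * y) X = 0"
  shows "tensor_lift fscale (\<lambda>x y. antipode \<mu> x * y) (X * Y) = 0"
proof -
  let ?T = "tensor_lift fscale (\<lambda>x y. antipode \<mu> x * y)"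
  note cmp = module_hom_compose [unfolded o_def] and T = module_hom_tensor_lift'
  note L = module_hom_mult_left and R = module_hom_mult_right
  have b: "?T (X * basis (c, d)) = antipode \<mu> (basis c) * (?T X * basis d)" for c d X
    by (rule free_module_hom_eqI [OF cmp [OF L T] cmp [OF T cmp [OF L R]]])
      (auto simp: basis_mult plus_prod_def tensor_lift_basis antipode_add mult.assoc)
  show ?thesis
    by (rule free_module_hom_eqI [OF cmp [OF R T] module_hom_zero])
      (auto simp: b assms)
qed

text \<open>Here the reversal puts \<open>c\<close> and \<open>S d\<close> around
  \<open>?T Y\<close>, so the kernel is a left ideal and the last word of a phrase decides.\<close>

lemma antipode_right_mult:
  assumes "tensor_lift fscale (\<lambda>x y. x * antipode \<mu> y) Y = 0"
  shows "tensor_lift fscale (\<lambda>x y. x * antipode \<mu> y) (X * Y) = 0"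
proof -
  let ?T = "tensor_lift fscale (\<lambda>x y. x * antipode \<mu> y)"
  note cmp = module_hom_compose [unfolded o_def] and T = module_hom_tensor_lift'
  note L = module_hom_mult_left and R = module_hom_mult_right
  have b: "?T (basis (c, d) * Y) = basis c * (?T Y * antipode \<mu> (basis d))" for c d Y
    by (rule free_module_hom_eqI [OF cmp [OF R T] cmp [OF T cmp [OF L R]]])
      (auto simp: basis_mult plus_prod_def tensor_lift_basis antipode_add simp flip: mult.assoc)
  show ?thesis
    by (rule free_module_hom_eqI [OF cmp [OF L T] module_hom_zero])
      (auto simp: b assms)
qed

lemma module_hom_convolution:
  "module_hom fscale fscale (convolution (comultiplication \<mu>) f g)"
  using module_hom_compose [OF algebra_hom.axioms(1) [OF algebra_hom_comultiplication] module_hom_tensor_lift']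
  by (simp add: convolution_def [abs_def] o_def)

section \<open>The Hopf algebra axioms\<close>

context
  fixes \<mu> :: "'a \<times> 'a \<Rightarrow> 'r::comm_ring_1" and \<epsilon> :: "('a, 'r) phrase_algebra \<Rightarrow> 'r"
  assumes \<epsilon>_hom: "algebra_hom fscale (*) \<epsilon>" and \<epsilon>_Cons: "\<And>w ws. \<epsilon> (basis (Phrase (w # ws))) = 0"
begin

interpretation \<epsilon>: algebra_hom fscale "(*)" \<epsilon> by (rule \<epsilon>_hom)

lemma \<epsilon>_mult_basis: "\<epsilon> (basis (b + c)) = \<epsilon> (basis b) * \<epsilon> (basis c)"
  by (simp flip: basis_mult \<epsilon>.hom_mult)

text \<open>Values of \<epsilon> are scalars, so the contraction is again an algebra homomorphism.
  On a word, \<epsilon> kills \<open>w\<close> tensor 1 and every nonempty list of left words; the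
  empty inscription remains.\<close>

lemma phrase_counit_left:
  "tensor_lift fscale (\<lambda>x y. fscale (\<epsilon> x) y) (comultiplication \<mu> a) = a"
proof -
  let ?T = "tensor_lift fscale (\<lambda>x y :: ('a, 'r) phrase_algebra. fscale (\<epsilon> x) y)"
  have T: "algebra_hom fscale fscale ?T"
    by (rule algebra_hom_basisI [OF module_hom_tensor_lift'])
      (auto simp: tensor_lift_basis zero_prod_def plus_prod_def \<epsilon>.hom_one \<epsilon>_mult_basis
        fscale_mult_left fscale_mult_right mult.commute \<epsilon>.hom_mult simp flip: basis_mult)
  have "?T (comultiplication \<mu> a) = id a"
  proof (rule phrase_algebra_hom_eqI [OF algebra_hom_compose [OF algebra_hom_comultiplication T] algebra_hom_id])
    fix w :: "'a list"
    have "inscription_sum \<mu> (\<lambda>l r. fscale (\<epsilon> (basis (Phrase l))) (basis (Phrase [r]))) w = word w"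
      by (subst inscription_sum_zero_Cons) (simp_all add: \<epsilon>_Cons \<epsilon>.hom_one word_def basis_empty_phrase)
    then show "?T (comultiplication \<mu> (word w)) = id (word w)"
      by (simp add: comultiplication_word module_hom.add [OF module_hom_tensor_lift']
          inscription_sum_hom [OF module_hom_tensor_lift'] tensor_lift_basis \<epsilon>_Cons)
  qed
  then show ?thesis by simp
qed

text \<open>Here \<open>w\<close> tensor 1 survives. Every inscription term dies, even when its
  right word is empty, since that still is a one-word phrase.\<close>

lemma phrase_counit_right:
  "tensor_lift fscale (\<lambda>x y. fscale (\<epsilon> y) x) (comultiplication \<mu> a) = a"
proof -
  let ?T = "tensor_lift fscale (\<lambda>x y :: ('a, 'r) phrase_algebra. fscale (\<epsilon> y) x)"
  have T: "algebra_hom fscale fscale ?T"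
    by (rule algebra_hom_basisI [OF module_hom_tensor_lift'])
      (auto simp: tensor_lift_basis zero_prod_def plus_prod_def \<epsilon>.hom_one \<epsilon>_mult_basis
        fscale_mult_left fscale_mult_right mult.commute \<epsilon>.hom_mult simp flip: basis_mult)
  have "?T (comultiplication \<mu> a) = id a"
  proof (rule phrase_algebra_hom_eqI [OF algebra_hom_compose [OF algebra_hom_comultiplication T] algebra_hom_id])
    fix w :: "'a list"
    show "?T (comultiplication \<mu> (word w)) = id (word w)"
      by (simp add: comultiplication_word module_hom.add [OF module_hom_tensor_lift']
          inscription_sum_hom [OF module_hom_tensor_lift'] tensor_lift_basis \<epsilon>_Cons \<epsilon>.hom_one)
        (simp add: inscription_sum_def word_def)
  qed
  then show ?thesis by simp
qed

text \<open>The convolutions with the antipode are known only to be linear, so all nonempty phrases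
  have to be checked; there the counit vanishes.\<close>

lemma phrase_algebra_eqI:
  fixes f g :: "('a, 'r) phrase_algebra \<Rightarrow> ('a, 'r) phrase_algebra"
  assumes "module_hom fscale fscale f" "module_hom fscale fscale g"
    and "f 1 = g 1" "\<And>w ws. f (basis (Phrase (w # ws))) = g (basis (Phrase (w # ws)))"
  shows "f x = g x"
proof (rule free_module_hom_eqI [OF assms(1,2)])
  fix p :: "'a phrase"
  show "f (basis p) = g (basis p)"
    using assms(3,4) by (cases p; cases "phrase_words p") (auto simp: basis_empty_phrase)
qed

lemma module_hom_unit_counit: "module_hom fscale fscale (\<lambda>a. fscale (\<epsilon> a) 1 :: ('a, 'r) phrase_algebra)"
  by unfold_locales (simp_all add: \<epsilon>.add \<epsilon>.scale free_module.scale_left_distrib)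

lemma phrase_antipode_left:
  "convolution (comultiplication \<mu>) (antipode \<mu>) id a = fscale (\<epsilon> a) 1"
proof (rule phrase_algebra_eqI [OF module_hom_convolution module_hom_unit_counit])
  show "convolution (comultiplication \<mu>) (antipode \<mu>) id 1 = fscale (\<epsilon> 1) 1"
    by (simp add: convolution_one antipode_one \<epsilon>.hom_one)
  fix w ws
  have "convolution (comultiplication \<mu>) (antipode \<mu>) id (word w) = 0"
    by (simp add: convolution_comultiplication_word antipode_word_eq)
  then show "convolution (comultiplication \<mu>) (antipode \<mu>) id (basis (Phrase (w # ws))) =
      fscale (\<epsilon> (basis (Phrase (w # ws)))) 1"
    by (simp add: convolution_def comultiplication_Cons antipode_left_mult \<epsilon>_Cons)
qed

text \<open>
  Since \<open>S = (S * id) * S = S * (id * S)\<close> for the convolution \<open>*\<close>, the values of \<open>id * S\<close> on the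
  right words of the inscriptions in \<open>w\<close> sum to zero, with weights that are 1 at the empty inscription.
\<close>

lemma phrase_antipode_right_word:
  "convolution (comultiplication \<mu>) id (antipode \<mu>) (word w) = 0"
proof (induction w rule: length_induct)
  case (1 w)
  let ?S = "antipode \<mu>" and ?\<Delta> = "comultiplication \<mu>"
  let ?E = "convolution ?\<Delta> id ?S"
  have "convolution ?\<Delta> ?S ?E (word w) = convolution ?\<Delta> (convolution ?\<Delta> ?S id) ?S (word w)"
    by (rule convolution_assoc [symmetric, OF algebra_hom.axioms(1) [OF algebra_hom_comultiplication] comultiplication_coassoc])
  also have "\<dots> = tensor_lift fscale (\<lambda>x y. fscale (\<epsilon> x) (?S y)) (?\<Delta> (word w))"
    by (simp add: convolution_def [of _ "\<lambda>a. fscale (\<epsilon> a) 1"] phrase_antipode_left [abs_def] fscale_mult_left)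
  also have "\<dots> = ?S (tensor_lift fscale (\<lambda>x y. fscale (\<epsilon> x) y) (?\<Delta> (word w)))"
    by (rule free_module_hom_eqI [OF module_hom_tensor_lift'
        module_hom_compose [OF module_hom_tensor_lift' module_hom_antipode, unfolded o_def]])
      (auto simp: tensor_lift_basis module_hom.scale [OF module_hom_antipode])
  also have "\<dots> = ?S (word w)" by (simp add: phrase_counit_left)
  \<comment> \<open>Since \<open>?E 1 = 1\<close>, the term from \<open>w\<close> tensor 1 equals
    \<open>?S (word w)\<close> and cancels. In the remaining sum the induction hypothesis kills
    every shorter right word.\<close>
  finally have "inscription_sum \<mu> (\<lambda>l r. ?S (basis (Phrase l)) * ?E (word r)) w = 0"
    by (simp add: convolution_comultiplication_word [of \<mu> ?S] convolution_one antipode_one)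
  moreover have "inscription_sum \<mu> (\<lambda>l r. ?S (basis (Phrase l)) * ?E (word r)) w =
      ?S (basis (Phrase [])) * ?E (word w)"
    using 1 by (intro inscription_sum_zero_except) (simp add: id_def)
  ultimately show ?case by (simp add: antipode_basis id_def)
qed

lemma phrase_antipode_right:
  "convolution (comultiplication \<mu>) id (antipode \<mu>) a = fscale (\<epsilon> a) 1"
proof (rule phrase_algebra_eqI [OF module_hom_convolution module_hom_unit_counit])
  show "convolution (comultiplication \<mu>) id (antipode \<mu>) 1 = fscale (\<epsilon> 1) 1"
    by (simp add: convolution_one antipode_one \<epsilon>.hom_one)
  fix w ws
  have "convolution (comultiplication \<mu>) id (antipode \<mu>) (basis (Phrase (w # ws))) = 0"
  \<comment> \<open>The induction strips words from the front until the last one, where the word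
    case applies.\<close>
  proof (induction ws arbitrary: w)
    case Nil
    then show ?case using phrase_antipode_right_word [of w] by (simp only: word_def)
  next
    case (Cons v ws)
    then show ?case
      by (simp add: convolution_def comultiplication_Cons [of \<mu> w] antipode_right_mult)
  qed
  then show "convolution (comultiplication \<mu>) id (antipode \<mu>) (basis (Phrase (w # ws))) =
      fscale (\<epsilon> (basis (Phrase (w # ws)))) 1"
    by (simp add: \<epsilon>_Cons)
qed

lemma phrase_hopf_algebra: "hopf_algebra (comultiplication \<mu>) \<epsilon> (antipode \<mu>)"
proof -
  have \<Delta>: "algebra_hom fscale fscale (comultiplication \<mu>)" by (rule algebra_hom_comultiplication)
  have "coalgebra (comultiplication \<mu>) \<epsilon>"
    by (intro coalgebra.intro coalgebra_axioms.intro algebra_hom.axioms(1) [OF \<Delta>] \<epsilon>.module_hom_axioms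
        comultiplication_coassoc phrase_counit_left phrase_counit_right)
  then show ?thesis
    using phrase_antipode_left phrase_antipode_right
    by (intro hopf_algebra.intro bialgebra.intro hopf_algebra_axioms.intro \<Delta> \<epsilon>_hom module_hom_antipode)
      (simp_all add: convolution_def)
qed

end

theorem corollary6p1p2:
  fixes \<mu> :: "'a \<times> 'a \<Rightarrow> 'r::comm_ring_1"
  shows "\<exists>\<epsilon> S. hopf_algebra (comultiplication \<mu>) \<epsilon> S"
  using phrase_algebra_counit phrase_hopf_algebra by metis

end
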